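(* For each $n=1,2,\ldots$ let $p_n\ge1$, let $\mathbf{X}_n\in\mathbb{R}^{n\times p_n}$ be a fixed design, $\beta^0_n\in\mathbb{R}^{p_n}$, and $\mathbf{Y}_n=\mathbf{X}_n\beta^0_n+\varepsilon_n$ with $\varepsilon_{n,1},\ldots,\varepsilon_{n,n}$ i.i.d. $\mathcal{N}(0,\sigma^2)$, $\sigma>0$. Let $\lambda_n>0$ with $\Omega_{\min}(\lambda_n)>0$ for all $n$ (not necessarily bounded away from $0$) and $$n^{1/2}\,\|\theta^0_n\|_2\,\lambda_n\,\Omega_{\min}(\lambda_n)^{-1/2}\,\lambda_{\min\neq0}(\hat\Sigma_n)^{-1}\to0\quad(n\to\infty),$$ i.e. $\lambda_n\Omega_{\min}(\lambda_n)^{-1/2}=o(n^{-1/2}\|\theta^0_n\|_2^{-1}\lambda_{\min\neq0}(\hat\Sigma_n))$. Let $\hat\beta_{\mathrm{init}}$ be an estimator of $\beta^0_n$ and let $\Delta_{j,n}>0$ ($1\le j\le p_n$) be constants satisfying assumption (A): $$\mathbb{P}\Big[\bigcap_{j=1}^{p_n}\Big\{\Big|a_{n,p;j}(\sigma)\sum_{k\neq j}(P_{\mathbf{X}})_{jk}(\hat\beta_{\mathrm{init};k}-\beta^0_k)\Big|\le\Delta_{j,n}\Big\}\Big]\to1\quad(n\to\infty).$$ Then: (i) for any sequence of indices $j=j_n\in\{1,\ldots,p_n\}$ with $\beta^0_{n,j_n}=0$ for all $n$, and every $u>0$, $$\limsup_{n\to\infty}\Big(\mathbb{P}\big[a_{n,p;j}(\sigma)|\hat\beta_{\mathrm{corr};j}|>u\big]-\mathbb{P}\big[|W|+\Delta_{j,n}>u\big]\Big)\le0,$$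 where $W\sim\mathcal{N}(0,1)$; (ii) for any sequence of subsets $G_n\subseteq\{1,\ldots,p_n\}$ with $\beta^0_{n,j}=0$ for all $j\in G_n$ and all $n$, and every $u>0$, $$\limsup_{n\to\infty}\Big(\mathbb{P}\big[\max_{j\in G_n}a_{n,p;j}(\sigma)|\hat\beta_{\mathrm{corr};j}|>u\big]-\mathbb{P}\big[\max_{j\in G_n}(a_{n,p;j}(\sigma)|Z_j|+\Delta_{j,n})>u\big]\Big)\le0,$$ where $(Z_1,\ldots,Z_{p_n})\sim\mathcal{N}_{p_n}(0,n^{-1}\sigma^2\Omega(\lambda_n))$.
   Context: All quantities depend on $n$ (index suppressed where convenient). $\hat\Sigma_n=n^{-1}\mathbf{X}_n^T\mathbf{X}_n$; $P_{\mathbf{X}}=\mathbf{X}_n^T(\mathbf{X}_n\mathbf{X}_n^T)^{-}\mathbf{X}_n$ (Moore–Penrose pseudo-inverse), the orthogonal projection onto the row space of $\mathbf{X}_n$; $\theta^0_n=P_{\mathbf{X}}\beta^0_n$. $\Omega(\lambda)=(\hat\Sigma_n+\lambda I)^{-1}\hat\Sigma_n(\hat\Sigma_n+\lambda I)^{-1}$, $\Omega_{\min}(\lambda)=\min_j\Omega_{jj}(\lambda)$; $\lambda_{\min\neq0}(A)$ is the smallest nonzero eigenvalue of a symmetric $A$. Ridge estimator $\hat\beta=(\hat\Sigma_n+\lambda_nI)^{-1}n^{-1}\mathbf{X}_n^T\mathbf{Y}_n$; corrected Ridge estimator $\hat\beta_{\mathrm{corr};j}=\hat\beta_j-\sum_{k\neq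 j}(P_{\mathbf{X}})_{jk}\hat\beta_{\mathrm{init};k}$. Normalizing factors $a_{n,p;j}(\sigma)=n^{1/2}\sigma^{-1}\Omega_{jj}(\lambda_n)^{-1/2}$. *)

theory Defs
  imports "HOL-Probability.Probability" "Jordan_Normal_Form.Matrix" "Jordan_Normal_Form.Char_Poly"
    "Jordan_Normal_Form.Gauss_Jordan_Elimination"
begin

text \<open>Matrices of varying dimension are JNF matrices (type real mat, dimensions as values).
  Indices are 0-based: the paper's index j in 1..p corresponds to j-1 in 0..p-1.\<close>

definition Sigma_hat :: "real mat \<Rightarrow> real mat" where
  "Sigma_hat X = (1 / real (dim_row X)) \<cdot>\<^sub>m (transpose_mat X * X)"

definition minv :: "real mat \<Rightarrow> real mat" where
  "minv A = the (mat_inverse A)"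

definition pinv :: "real mat \<Rightarrow> real mat" where
  "pinv A = (THE B. B \<in> carrier_mat (dim_col A) (dim_row A) \<and>
      A * B * A = A \<and> B * A * B = B \<and>
      transpose_mat (A * B) = A * B \<and> transpose_mat (B * A) = B * A)"

text \<open>P_X = X^T (X X^T)^- X, orthogonal projection onto the row space of X.\<close>
definition proj_X :: "real mat \<Rightarrow> real mat" where
  "proj_X X = transpose_mat X * pinv (X * transpose_mat X) * X"

definition Omega :: "real mat \<Rightarrow> real \<Rightarrow> real mat" where
  "Omega X lam = (let S = Sigma_hat X; R = minv (S + lam \<cdot>\<^sub>m 1\<^sub>m (dim_col X)) in R * S * R)"

definition Omega_min :: "real mat \<Rightarrow> real \<Rightarrow> real" where
  "Omega_min X lam = Min ((\<lambda>j. Omega X lam $$ (j, j)) ` {..<dim_col X})"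

definition lambda_min_nz :: "real mat \<Rightarrow> real" where
  "lambda_min_nz A = Min {k. eigenvalue A k \<and> k \<noteq> 0}"

definition norm2 :: "real vec \<Rightarrow> real" where
  "norm2 v = sqrt (\<Sum>i<dim_vec v. (v $ i)\<^sup>2)"

definition ridge :: "real mat \<Rightarrow> real \<Rightarrow> real vec \<Rightarrow> real vec" where
  "ridge X lam Y = minv (Sigma_hat X + lam \<cdot>\<^sub>m 1\<^sub>m (dim_col X))
      *\<^sub>v ((1 / real (dim_row X)) \<cdot>\<^sub>v (transpose_mat X *\<^sub>v Y))"

definition ridge_corr :: "real mat \<Rightarrow> real \<Rightarrow> real vec \<Rightarrow> (nat \<Rightarrow> real) \<Rightarrow> nat \<Rightarrow> real" where
  "ridge_corr X lam Y binit j = ridge X lam Y $ j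
      - (\<Sum>k\<in>{..<dim_col X} - {j}. proj_X X $$ (j, k) * binit k)"

definition a_fac :: "real mat \<Rightarrow> real \<Rightarrow> real \<Rightarrow> nat \<Rightarrow> real" where
  "a_fac X lam \<sigma> j = sqrt (real (dim_row X)) / \<sigma> / sqrt (Omega X lam $$ (j, j))"

definition normal_law :: "real \<Rightarrow> real \<Rightarrow> real measure" where
  "normal_law m s2 = (if s2 = 0 then return lborel m
                      else density lborel (\<lambda>x. ennreal (normal_density m (sqrt s2) x)))"

text \<open>Z = (Z_0,..,Z_{p-1}) on probability space N is centred Gaussian N_p(0, C)
  (every linear combination v^T Z is N(0, v^T C v); Cramer--Wold).\<close>
definition gaussian_vec :: "'b measure \<Rightarrow> ('b \<Rightarrow> nat \<Rightarrow> real) \<Rightarrow> nat \<Rightarrow> real mat \<Rightarrow> bool" where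
  "gaussian_vec N Z p C \<longleftrightarrow>
     (\<forall>j<p. (\<lambda>\<omega>. Z \<omega> j) \<in> borel_measurable N) \<and>
     (\<forall>v :: nat \<Rightarrow> real. distr N lborel (\<lambda>\<omega>. \<Sum>j<p. v j * Z \<omega> j)
         = normal_law 0 (\<Sum>i<p. \<Sum>j<p. v i * C $$ (i, j) * v j))"

end

theory Submission
  imports Defs "Jordan_Normal_Form.Spectral_Radius"
begin

text \<open>With \<open>\<theta> = P\<^sub>X \<beta>\<close> and \<open>R = (\<Sigma> + \<lambda> I)\<^sup>-\<^sup>1\<close>, the corrected estimator at a null coordinate is
  a centred Gaussian term, plus the bias \<open>- \<lambda> (R \<theta>) j\<close>, plus the term that the assumption on the
  initial estimator bounds by \<open>\<Delta> j\<close>. Since \<open>R \<theta>\<close> is orthogonal to the kernel of \<open>\<Sigma>\<close>, the bias is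
  at most \<open>\<lambda>\<close> times the norm of \<open>\<theta>\<close> divided by the smallest nonzero eigenvalue, so that after
  normalization it vanishes uniformly in \<open>j\<close>. What remains is to move the threshold \<open>u\<close> by \<open>o(1)\<close>
  in the tail of \<open>max (\<bar>Z j\<bar> + \<Delta> j)\<close>, although the number of coordinates is unrestricted. This
  works because \<open>u\<close> is fixed: for unit-variance Gaussians with constants \<open>c k \<le> u\<close> the probability
  of \<open>- \<delta> < max (\<eta> k - c k) \<le> 0\<close> is \<open>O(\<delta>)\<close> with a constant depending on \<open>u\<close> only.\<close>

subsection \<open>The Cramer-Wold device\<close>

text \<open>A union bound over the coordinates would cost a factor \<open>p n\<close>, and
  anti-concentration of a Gaussian maximum at an arbitrary level in general deteriorates as the
  number of variables grows. Here the level is harmless: every constant \<open>c k\<close> has the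
  form \<open>u - \<Delta> j\<close> and is at most \<open>u\<close>, and moving a standard normal
  value \<open>s \<le> u\<close> upwards by some \<open>t\<close> between 0 and 1 multiplies its
  density by no less than \<open>exp (- u - 1 / 2)\<close>. This also bridges the two sides of the
  comparison: the noise and \<open>Z\<close> live on different spaces, and \<open>Z\<close> is
  specified only through the laws of its linear combinations, whereas the events concern all
  coordinates jointly. The Cramer-Wold device transfers the probabilities of product events from one
  space to the other.\<close>

text \<open>Divided by their common total mass, the weighted measures become probability measures,
  and the two kinds of integrals are, up to that mass, the real and imaginary parts of the
  characteristic functions of \<open>X\<close> and \<open>X'\<close> under them; Levy uniqueness
  applies. The masses agree by the cosine identity at \<open>t = 0\<close>.\<close>

lemma weighted_law_unique:
  fixes X :: "'a \<Rightarrow> real" and X' :: "'b \<Rightarrow> real"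
  assumes "prob_space M" "prob_space N"
    and [measurable]: "X \<in> borel_measurable M" "w \<in> borel_measurable M"
      "X' \<in> borel_measurable N" "w' \<in> borel_measurable N"
    and w: "\<And>\<omega>. 1 \<le> w \<omega> \<and> w \<omega> \<le> C" and w': "\<And>\<omega>. 1 \<le> w' \<omega> \<and> w' \<omega> \<le> (C::real)"
    and cos_eq: "\<And>t. (\<integral>\<omega>. w \<omega> * cos (t * X \<omega>) \<partial>M) = (\<integral>\<omega>. w' \<omega> * cos (t * X' \<omega>) \<partial>N)"
    and sin_eq: "\<And>t. (\<integral>\<omega>. w \<omega> * sin (t * X \<omega>) \<partial>M) = (\<integral>\<omega>. w' \<omega> * sin (t * X' \<omega>) \<partial>N)"
    and B: "B \<in> sets borel"
  shows "(\<integral>\<omega>. w \<omega> * indicator B (X \<omega>) \<partial>M) = (\<integral>\<omega>. w' \<omega> * indicator B (X' \<omega>) \<partial>N)"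
proof -
  define m where "m = (\<integral>\<omega>. w \<omega> \<partial>M)"
  have m': "m = (\<integral>\<omega>. w' \<omega> \<partial>N)" using cos_eq[of 0] by (simp add: m_def)
  \<comment> \<open>Stated for a generic space, since it is applied to \<open>M\<close> and to
    \<open>N\<close>, whose point types differ. The lower bound 1 on the weight keeps the mass
    \<open>m\<close> positive.\<close>
  have general: "real_distribution (distr (density P (\<lambda>\<omega>. ennreal (v \<omega> / m))) borel Y) \<and>
      char (distr (density P (\<lambda>\<omega>. ennreal (v \<omega> / m))) borel Y) = 
        (\<lambda>t. complex_of_real (1/m) * (complex_of_real (\<integral>\<omega>. v \<omega> * cos (t * Y \<omega>) \<partial>P) + \<i> * complex_of_real (\<integral>\<omega>. v \<omega> * sin (t * Y \<omega>) \<partial>P))) \<and>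
      measure (distr (density P (\<lambda>\<omega>. ennreal (v \<omega> / m))) borel Y) B = (1/m) * (\<integral>\<omega>. v \<omega> * indicator B (Y \<omega>) \<partial>P) \<and> m > 0"
    if "prob_space P" and [measurable]: "Y \<in> borel_measurable P" "v \<in> borel_measurable P"
      and v: "\<And>\<omega>. 1 \<le> v \<omega> \<and> v \<omega> \<le> C" and mv: "m = (\<integral>\<omega>. v \<omega> \<partial>P)" for P :: "'z measure" and Y :: "'z \<Rightarrow> real" and v
  proof -
    interpret prob_space P by fact
    have bdint: "integrable P (\<lambda>\<omega>. v \<omega> * f \<omega>)" if [measurable]: "f \<in> borel_measurable P" and "\<And>\<omega>. \<bar>f \<omega>\<bar> \<le> 1" for f :: "'z \<Rightarrow> real"
    proof (rule integrable_const_bound[of _ C])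
      show "AE x in P. norm (v x * f x) \<le> C"
      proof (rule AE_I2)
        fix x show "norm (v x * f x) \<le> C"
          using mult_mono[of "\<bar>v x\<bar>" C "\<bar>f x\<bar>" 1] v[of x] that(2)[of x] by (simp add: abs_mult)
      qed
    qed simp
    have iv: "integrable P v" using bdint[of "\<lambda>_. 1"] by simp
    have "(\<integral>\<omega>. 1 \<partial>P) \<le> (\<integral>\<omega>. v \<omega> \<partial>P)" by (rule integral_mono) (use iv v in auto)
    then have m1: "m \<ge> 1" using mv by (simp add: prob_space)
    have nn: "v \<omega> / m \<ge> 0" for \<omega> using m1 v[of \<omega>] by simp
    let ?D = "density P (\<lambda>\<omega>. ennreal (v \<omega> / m))"
    have "emeasure ?D (space ?D) = (\<integral>\<^sup>+\<omega>. ennreal (v \<omega> / m) \<partial>P)"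
      by (subst emeasure_density) (auto intro!: nn_integral_cong)
    also have "\<dots> = ennreal (\<integral>\<omega>. v \<omega> / m \<partial>P)"
      by (rule nn_integral_eq_integral) (use iv nn in auto)
    also have "\<dots> = 1" using m1 mv by simp
    finally have pD: "prob_space ?D" by (rule prob_spaceI)
    interpret D: prob_space ?D by (rule pD)
    have rd: "real_distribution (distr ?D borel Y)"
      by (intro D.real_distribution_distr) simp
    have "char (distr ?D borel Y) t = complex_of_real (1/m) * (complex_of_real (\<integral>\<omega>. v \<omega> * cos (t * Y \<omega>) \<partial>P) + \<i> * complex_of_real (\<integral>\<omega>. v \<omega> * sin (t * Y \<omega>) \<partial>P))" for t
    proof -
      have "char (distr ?D borel Y) t = (CLINT \<omega>|?D. iexp (t * Y \<omega>))"
        unfolding char_def by (subst integral_distr) auto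
      also have "\<dots> = (CLINT \<omega>|P. (v \<omega> / m) *\<^sub>R iexp (t * Y \<omega>))"
        by (subst integral_density) (use nn in auto)
      also have "\<dots> = (CLINT \<omega>|P. complex_of_real (1/m) * (complex_of_real (v \<omega> * cos (t * Y \<omega>)) + \<i> * complex_of_real (v \<omega> * sin (t * Y \<omega>))))"
        by (intro Bochner_Integration.integral_cong refl) (simp add: complex_eq_iff Re_exp Im_exp)
      also have "\<dots> = complex_of_real (1/m) * (CLINT \<omega>|P. (complex_of_real (v \<omega> * cos (t * Y \<omega>)) + \<i> * complex_of_real (v \<omega> * sin (t * Y \<omega>))))"
        by (rule integral_mult_right_zero)
      also have "(CLINT \<omega>|P. (complex_of_real (v \<omega> * cos (t * Y \<omega>)) + \<i> * complex_of_real (v \<omega> * sin (t * Y \<omega>)))) =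
          (CLINT \<omega>|P. complex_of_real (v \<omega> * cos (t * Y \<omega>))) + (CLINT \<omega>|P. \<i> * complex_of_real (v \<omega> * sin (t * Y \<omega>)))"
        by (intro Bochner_Integration.integral_add integrable_mult_right integrable_of_real bdint) auto
      finally show ?thesis by (simp only: integral_mult_right_zero integral_complex_of_real)
    qed
    moreover have "measure (distr ?D borel Y) B = (1/m) * (\<integral>\<omega>. v \<omega> * indicator B (Y \<omega>) \<partial>P)"
    proof -
      have "measure (distr ?D borel Y) B = (\<integral>x. indicator B x \<partial>(distr ?D borel Y))" using B by simp
      also have "\<dots> = (\<integral>\<omega>. indicator B (Y \<omega>) \<partial>?D)" by (subst integral_distr) (use B in auto)
      also have "\<dots> = (\<integral>\<omega>. (v \<omega> / m) *\<^sub>R indicator B (Y \<omega>) \<partial>P)"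
        by (subst integral_density) (use nn B in auto)
      also have "\<dots> = (\<integral>\<omega>. (1/m) * (v \<omega> * indicator B (Y \<omega>)) \<partial>P)"
        by (intro Bochner_Integration.integral_cong refl) simp
      finally show ?thesis by simp
    qed
    ultimately show ?thesis using rd m1 by auto
  qed
  note gM = general[OF assms(1) assms(3,4) w m_def]
  note gN = general[OF assms(2) assms(5,6) w' m']
  have "distr (density M (\<lambda>\<omega>. ennreal (w \<omega> / m))) borel X = distr (density N (\<lambda>\<omega>. ennreal (w' \<omega> / m))) borel X'"
    by (rule Levy_uniqueness) (use gM gN cos_eq sin_eq in auto)
  then show ?thesis using gM gN by auto
qed

definition joint_char :: "'a measure \<Rightarrow> 'i set \<Rightarrow> ('i \<Rightarrow> 'a \<Rightarrow> real) \<Rightarrow> ('i \<Rightarrow> real) \<Rightarrow> complex" where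
  "joint_char M I X v = (CLINT \<omega>|M. iexp (\<Sum>i\<in>I. v i * X i \<omega>))"

text \<open>With a free phase \<open>c\<close> these real integrals carry the whole complex value:
  \<open>c = 0\<close> gives the real part and \<open>c = - pi/2\<close> the imaginary part. The
  induction in \<open>cramer_wold\<close> can therefore stay real-valued.\<close>

lemma joint_char_cos:
  assumes "prob_space M" and [measurable]: "\<And>i. i \<in> I \<Longrightarrow> X i \<in> borel_measurable M"
  shows "(\<integral>\<omega>. cos (c + (\<Sum>i\<in>I. v i * X i \<omega>)) \<partial>M) = Re (iexp c * joint_char M I X v)"
proof -
  interpret prob_space M by fact
  have int: "integrable M (\<lambda>\<omega>. iexp c * iexp (\<Sum>i\<in>I. v i * X i \<omega>))"
    by (intro integrable_mult_right integrable_iexp) auto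
  have "iexp c * joint_char M I X v = (CLINT \<omega>|M. iexp c * iexp (\<Sum>i\<in>I. v i * X i \<omega>))"
    unfolding joint_char_def by simp
  then have "Re (iexp c * joint_char M I X v) = (\<integral>\<omega>. Re (iexp c * iexp (\<Sum>i\<in>I. v i * X i \<omega>)) \<partial>M)"
    by (simp only: integral_bounded_linear[OF bounded_linear_Re int])
  also have "\<dots> = (\<integral>\<omega>. cos (c + (\<Sum>i\<in>I. v i * X i \<omega>)) \<partial>M)"
    by (intro Bochner_Integration.integral_cong refl) (simp add: Re_exp Im_exp cos_add)
  finally show ?thesis by simp
qed

text \<open>The coordinates are converted one at a time from a phase factor into an indicator; the
  integrand multiplying a coordinate becomes a probability density after adding the constant 2.\<close>
theorem cramer_wold:
  fixes X :: "'i \<Rightarrow> 'a \<Rightarrow> real" and X' :: "'i \<Rightarrow> 'b \<Rightarrow> real"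
  assumes M: "prob_space M" and N: "prob_space N" and I: "finite I"
    and X[measurable]: "\<And>i. i \<in> I \<Longrightarrow> X i \<in> borel_measurable M"
    and X'[measurable]: "\<And>i. i \<in> I \<Longrightarrow> X' i \<in> borel_measurable N"
    and eq: "\<And>v. joint_char M I X v = joint_char N I X' v"
    and B[measurable]: "\<And>i. i \<in> I \<Longrightarrow> B i \<in> sets borel"
  shows "measure M {\<omega> \<in> space M. \<forall>i\<in>I. X i \<omega> \<in> B i} = measure N {\<omega> \<in> space N. \<forall>i\<in>I. X' i \<omega> \<in> B i}"
proof -
  interpret M: prob_space M by fact
  interpret N: prob_space N by fact
  have plain: "(\<integral>\<omega>. cos (c + (\<Sum>i\<in>I. v i * X i \<omega>)) \<partial>M) = (\<integral>\<omega>. cos (c + (\<Sum>i\<in>I. v i * X' i \<omega>)) \<partial>N)" for c v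
    by (simp add: joint_char_cos M N X X' eq)
  have main: "\<forall>v c. (\<integral>\<omega>. (\<Prod>i\<in>J. indicator (B i) (X i \<omega>)) * cos (c + (\<Sum>i\<in>I-J. v i * X i \<omega>)) \<partial>M)
      = (\<integral>\<omega>. (\<Prod>i\<in>J. indicator (B i) (X' i \<omega>)) * cos (c + (\<Sum>i\<in>I-J. v i * X' i \<omega>)) \<partial>N)"
    if "J \<subseteq> I" for J
    using finite_subset[OF that I] that
  proof (induction J rule: finite_induct)
    case empty
    then show ?case using plain by simp
  next
    case (insert k J)
    then have k: "k \<in> I" "k \<notin> J" and JI: "J \<subseteq> I" and finJ: "finite J" by auto
    have [measurable]: "X i \<in> borel_measurable M" "X' i \<in> borel_measurable N" "B i \<in> sets borel" if "i \<in> J" for i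
      using that JI X X' B by auto
    note [measurable] = X[OF k(1)] X'[OF k(1)] B[OF k(1)]
    note IH = insert.IH[OF JI]
    have bd: "\<bar>(\<Prod>i\<in>J. indicator (B i) (Z i)) * cos y\<bar> \<le> 1" for Z :: "'i \<Rightarrow> real" and y :: real
    proof -
      have "\<bar>\<Prod>i\<in>J. indicator (B i) (Z i) :: real\<bar> \<le> 1"
        unfolding abs_prod by (intro prod_le_1) (auto simp: indicator_def)
      then show ?thesis using mult_mono[of "\<bar>\<Prod>i\<in>J. indicator (B i) (Z i) :: real\<bar>" 1 "\<bar>cos y\<bar>" 1]
        by (simp add: abs_mult)
    qed
    show ?case
    proof (intro allI)
      fix v :: "'i \<Rightarrow> real" and c
      define f where "f c \<omega> = (\<Prod>i\<in>J. indicator (B i) (X i \<omega>)) * cos (c + (\<Sum>i\<in>I - insert k J. v i * X i \<omega>))" for c \<omega>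
      define f' where "f' c \<omega> = (\<Prod>i\<in>J. indicator (B i) (X' i \<omega>)) * cos (c + (\<Sum>i\<in>I - insert k J. v i * X' i \<omega>))" for c \<omega>
      have [measurable]: "f c \<in> borel_measurable M" for c
        unfolding f_def by measurable (use JI in auto)
      have [measurable]: "f' c \<in> borel_measurable N" for c
        unfolding f'_def by measurable (use JI in auto)
      have b: "\<bar>f c \<omega>\<bar> \<le> 1" "\<bar>f' c \<omega>'\<bar> \<le> 1" for \<omega> \<omega>' c unfolding f_def f'_def by (rule bd)+
      have shiftM: "(\<integral>\<omega>. (\<Prod>i\<in>J. indicator (B i) (X i \<omega>)) * cos (c + t * X k \<omega> + (\<Sum>i\<in>I - insert k J. v i * X i \<omega>)) \<partial>M) =
         (\<integral>\<omega>. (\<Prod>i\<in>J. indicator (B i) (X' i \<omega>)) * cos (c + t * X' k \<omega> + (\<Sum>i\<in>I - insert k J. v i * X' i \<omega>)) \<partial>N)" for c t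
      proof -
        have IJ: "I - J = insert k (I - insert k J)" using k by auto
        have e: "(\<Sum>i\<in>I-J. (v(k:=t)) i * Z i) = t * Z k + (\<Sum>i\<in>I - insert k J. v i * Z i)" for Z :: "'i \<Rightarrow> real"
          unfolding IJ by (subst sum.insert) (use I in \<open>auto intro!: sum.cong\<close>)
        show ?thesis using IH[rule_format, of c "v(k:=t)"] by (simp only: e add.assoc)
      qed
      \<comment> \<open>Product-to-sum formulas: a factor \<open>cos (t * x)\<close> or
        \<open>sin (t * x)\<close> is absorbed into two phases with frequencies \<open>t\<close> and
        \<open>- t\<close> at coordinate \<open>k\<close>, to which the induction hypothesis
        applies. The sine costs an extra phase \<open>pi/2\<close>, which is why the induction
        quantifies over \<open>c\<close>.\<close>
      have ptc: "P * cos (c + S) * cos (t * x) = 1/2 * (P * cos (c + t * x + S)) + 1/2 * (P * cos (c + (-t) * x + S))"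
        and pts: "P * cos (c + S) * sin (t * x) = 1/2 * (P * cos ((c - pi/2) + t * x + S)) - 1/2 * (P * cos ((c - pi/2) + (-t) * x + S))"
        for P c S t x :: real
      proof -
        have e: "c + t * x + S = (c + S) + t * x" "c + (-t) * x + S = (c + S) - t * x"
          "(c - pi/2) + t * x + S = ((c + S) + t * x) - pi/2" "(c - pi/2) + (-t) * x + S = ((c + S) - t * x) - pi/2" by simp_all
        show "P * cos (c + S) * cos (t * x) = 1/2 * (P * cos (c + t * x + S)) + 1/2 * (P * cos (c + (-t) * x + S))"
          unfolding e cos_add[of "c+S"] cos_diff[of "c+S"] by (simp add: field_simps)
        have h: "cos (z - pi/2) = sin z" for z :: real by (simp add: cos_diff)
        show "P * cos (c + S) * sin (t * x) = 1/2 * (P * cos ((c - pi/2) + t * x + S)) - 1/2 * (P * cos ((c - pi/2) + (-t) * x + S))"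
          unfolding e h sin_add[of "c+S"] sin_diff[of "c+S"] by (simp add: field_simps)
      qed
      have prodsum: "f c \<omega> * cos (t * X k \<omega>) = 1/2 * ((\<Prod>i\<in>J. indicator (B i) (X i \<omega>)) * cos (c + t * X k \<omega> + (\<Sum>i\<in>I - insert k J. v i * X i \<omega>)))
           + 1/2 * ((\<Prod>i\<in>J. indicator (B i) (X i \<omega>)) * cos (c + (-t) * X k \<omega> + (\<Sum>i\<in>I - insert k J. v i * X i \<omega>)))" for c t \<omega>
        unfolding f_def by (rule ptc)
      have prodsum': "f' c \<omega> * cos (t * X' k \<omega>) = 1/2 * ((\<Prod>i\<in>J. indicator (B i) (X' i \<omega>)) * cos (c + t * X' k \<omega> + (\<Sum>i\<in>I - insert k J. v i * X' i \<omega>)))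
           + 1/2 * ((\<Prod>i\<in>J. indicator (B i) (X' i \<omega>)) * cos (c + (-t) * X' k \<omega> + (\<Sum>i\<in>I - insert k J. v i * X' i \<omega>)))" for c t \<omega>
        unfolding f'_def by (rule ptc)
      have sprodsum: "f c \<omega> * sin (t * X k \<omega>) = 1/2 * ((\<Prod>i\<in>J. indicator (B i) (X i \<omega>)) * cos ((c - pi/2) + t * X k \<omega> + (\<Sum>i\<in>I - insert k J. v i * X i \<omega>)))
           - 1/2 * ((\<Prod>i\<in>J. indicator (B i) (X i \<omega>)) * cos ((c - pi/2) + (-t) * X k \<omega> + (\<Sum>i\<in>I - insert k J. v i * X i \<omega>)))" for c t \<omega>
        unfolding f_def by (rule pts)
      have sprodsum': "f' c \<omega> * sin (t * X' k \<omega>) = 1/2 * ((\<Prod>i\<in>J. indicator (B i) (X' i \<omega>)) * cos ((c - pi/2) + t * X' k \<omega> + (\<Sum>i\<in>I - insert k J. v i * X' i \<omega>)))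
           - 1/2 * ((\<Prod>i\<in>J. indicator (B i) (X' i \<omega>)) * cos ((c - pi/2) + (-t) * X' k \<omega> + (\<Sum>i\<in>I - insert k J. v i * X' i \<omega>)))" for c t \<omega>
        unfolding f'_def by (rule pts)
      have intM: "integrable M (\<lambda>\<omega>. (\<Prod>i\<in>J. indicator (B i) (X i \<omega>)) * cos (c + t * X k \<omega> + (\<Sum>i\<in>I - insert k J. v i * X i \<omega>)))" for c t
        by (rule M.integrable_const_bound[of _ 1]) (use bd in auto)
      have intN: "integrable N (\<lambda>\<omega>. (\<Prod>i\<in>J. indicator (B i) (X' i \<omega>)) * cos (c + t * X' k \<omega> + (\<Sum>i\<in>I - insert k J. v i * X' i \<omega>)))" for c t
        by (rule N.integrable_const_bound[of _ 1]) (use bd in auto)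
      have fcos: "(\<integral>\<omega>. f c \<omega> * cos (t * X k \<omega>) \<partial>M) = (\<integral>\<omega>. f' c \<omega> * cos (t * X' k \<omega>) \<partial>N)" for c t
        unfolding prodsum prodsum' using intM[of c t] intM[of c "-t"] intN[of c t] intN[of c "-t"]
        by (simp add: shiftM[of c t, simplified] shiftM[of c "-t", simplified])
      have fsin: "(\<integral>\<omega>. f c \<omega> * sin (t * X k \<omega>) \<partial>M) = (\<integral>\<omega>. f' c \<omega> * sin (t * X' k \<omega>) \<partial>N)" for c t
        unfolding sprodsum sprodsum' using intM[of "c-pi/2" t] intM[of "c-pi/2" "-t"] intN[of "c-pi/2" t] intN[of "c-pi/2" "-t"]
        by (simp add: shiftM[of "c-pi/2" t, simplified] shiftM[of "c-pi/2" "-t", simplified])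
      have single: "(\<Sum>i\<in>I. (if i = k then t else 0) * Z i) = t * Z k" for t and Z :: "'i \<Rightarrow> real"
        using I k by (simp add: if_distrib[of "\<lambda>x. x * _"] cong: if_cong)
      have kcos: "(\<integral>\<omega>. cos (t * X k \<omega>) \<partial>M) = (\<integral>\<omega>. cos (t * X' k \<omega>) \<partial>N)" for t
        using plain[of 0 "\<lambda>i. if i = k then t else 0"] by (simp add: single)
      have ksin: "(\<integral>\<omega>. sin (t * X k \<omega>) \<partial>M) = (\<integral>\<omega>. sin (t * X' k \<omega>) \<partial>N)" for t
        using plain[of "-(pi/2)" "\<lambda>i. if i = k then t else 0"] by (simp add: single cos_diff)
      have i1: "integrable M (\<lambda>\<omega>. f c \<omega> * cos (t * X k \<omega>))" "integrable M (\<lambda>\<omega>. f c \<omega> * sin (t * X k \<omega>))"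
        "integrable N (\<lambda>\<omega>. f' c \<omega> * cos (t * X' k \<omega>))" "integrable N (\<lambda>\<omega>. f' c \<omega> * sin (t * X' k \<omega>))"
        "integrable M (\<lambda>\<omega>. f c \<omega> * indicator (B k) (X k \<omega>))" "integrable N (\<lambda>\<omega>. f' c \<omega> * indicator (B k) (X' k \<omega>))" for c t
        by (rule M.integrable_const_bound[of _ 1] N.integrable_const_bound[of _ 1];
            use b[of c] in \<open>auto simp: abs_mult indicator_def intro!: mult_le_one\<close>)+
      have i2: "integrable M (\<lambda>\<omega>. cos (t * X k \<omega>))" "integrable M (\<lambda>\<omega>. sin (t * X k \<omega>))"
        "integrable N (\<lambda>\<omega>. cos (t * X' k \<omega>))" "integrable N (\<lambda>\<omega>. sin (t * X' k \<omega>))"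
        "integrable M (\<lambda>\<omega>. indicator (B k) (X k \<omega>) :: real)" "integrable N (\<lambda>\<omega>. indicator (B k) (X' k \<omega>) :: real)" for t
        by (rule M.integrable_const_bound[of _ 1] N.integrable_const_bound[of _ 1]; auto simp: indicator_def)+
      have A: "(\<integral>\<omega>. (2 + f c \<omega>) * indicator (B k) (X k \<omega>) \<partial>M) = (\<integral>\<omega>. (2 + f' c \<omega>) * indicator (B k) (X' k \<omega>) \<partial>N)"
      proof (rule weighted_law_unique[where C=3, OF M N])
        show "1 \<le> 2 + f c \<omega> \<and> 2 + f c \<omega> \<le> 3" for \<omega> using b(1)[of c \<omega>] by linarith
        show "1 \<le> 2 + f' c \<omega> \<and> 2 + f' c \<omega> \<le> 3" for \<omega> using b(2)[of c \<omega>] by linarith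
        show "(\<integral>\<omega>. (2 + f c \<omega>) * cos (t * X k \<omega>) \<partial>M) = (\<integral>\<omega>. (2 + f' c \<omega>) * cos (t * X' k \<omega>) \<partial>N)" for t
          using i1(1-4)[of c t] i2(1-4)[of t] by (simp add: distrib_right fcos kcos)
        show "(\<integral>\<omega>. (2 + f c \<omega>) * sin (t * X k \<omega>) \<partial>M) = (\<integral>\<omega>. (2 + f' c \<omega>) * sin (t * X' k \<omega>) \<partial>N)" for t
          using i1(1-4)[of c t] i2(1-4)[of t] by (simp add: distrib_right fsin ksin)
      qed measurable
      \<comment> \<open>The contribution of the constant 2 alone, to be subtracted from
        \<open>A\<close>; \<open>f c\<close> may be negative and is not itself a weight.\<close>
      have A2: "(\<integral>\<omega>. 2 * indicator (B k) (X k \<omega>) \<partial>M) = (\<integral>\<omega>. (2::real) * indicator (B k) (X' k \<omega>) \<partial>N)"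
        by (rule weighted_law_unique[where C=2, OF M N]) (use i2 in \<open>simp_all add: kcos ksin\<close>)
      have A3: "(\<integral>\<omega>. f c \<omega> * indicator (B k) (X k \<omega>) \<partial>M) = (\<integral>\<omega>. f' c \<omega> * indicator (B k) (X' k \<omega>) \<partial>N)"
        using A A2 i1(5,6)[of c] i2(5,6) by (simp add: distrib_right)
      show "(\<integral>\<omega>. (\<Prod>i\<in>insert k J. indicator (B i) (X i \<omega>)) * cos (c + (\<Sum>i\<in>I-insert k J. v i * X i \<omega>)) \<partial>M)
      = (\<integral>\<omega>. (\<Prod>i\<in>insert k J. indicator (B i) (X' i \<omega>)) * cos (c + (\<Sum>i\<in>I-insert k J. v i * X' i \<omega>)) \<partial>N)"
        using A3 k finJ unfolding f_def f'_def by (simp add: ac_simps)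
    qed
  qed
  have ind: "(\<Prod>i\<in>I. indicator (B i) (Z i)) = (if \<forall>i\<in>I. Z i \<in> B i then 1 else 0::real)" for Z
    using I by (auto simp: indicator_def prod_zero_iff)
  have "(\<integral>\<omega>. (\<Prod>i\<in>I. indicator (B i) (X i \<omega>)) \<partial>M) = measure M {\<omega> \<in> space M. \<forall>i\<in>I. X i \<omega> \<in> B i}"
  proof -
    have "(\<integral>\<omega>. (\<Prod>i\<in>I. indicator (B i) (X i \<omega>)) \<partial>M) = (\<integral>\<omega>. indicat_real {\<omega> \<in> space M. \<forall>i\<in>I. X i \<omega> \<in> B i} \<omega> \<partial>M)"
      by (intro Bochner_Integration.integral_cong refl) (subst ind, simp add: indicator_def)
    also have "\<dots> = measure M {\<omega> \<in> space M. \<forall>i\<in>I. X i \<omega> \<in> B i}" 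
      by (simp add: Int_absorb2 subset_eq)
    finally show ?thesis .
  qed
  moreover have "(\<integral>\<omega>. (\<Prod>i\<in>I. indicator (B i) (X' i \<omega>)) \<partial>N) = measure N {\<omega> \<in> space N. \<forall>i\<in>I. X' i \<omega> \<in> B i}"
  proof -
    have "(\<integral>\<omega>. (\<Prod>i\<in>I. indicator (B i) (X' i \<omega>)) \<partial>N) = (\<integral>\<omega>. indicat_real {\<omega> \<in> space N. \<forall>i\<in>I. X' i \<omega> \<in> B i} \<omega> \<partial>N)"
      by (intro Bochner_Integration.integral_cong refl) (subst ind, simp add: indicator_def)
    also have "\<dots> = measure N {\<omega> \<in> space N. \<forall>i\<in>I. X' i \<omega> \<in> B i}" 
      by (simp add: Int_absorb2 subset_eq)
    finally show ?thesis .
  qed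
  \<comment> \<open>With \<open>J = I\<close> no coordinate is left in the phase, and
    \<open>c = 0\<close> turns the cosine into 1.\<close>
  ultimately show ?thesis using main[of I, rule_format, of 0] by simp
qed

subsection \<open>Anti-concentration of Gaussian maxima\<close>

text \<open>Encoded through the joint characteristic function so that singular covariances are
  covered. They occur for rank-deficient designs and for a family that contains each variable
  together with its negative.\<close>

definition gaussian_family :: "'a measure \<Rightarrow> 'i set \<Rightarrow> ('i \<Rightarrow> 'a \<Rightarrow> real) \<Rightarrow> ('i \<Rightarrow> 'i \<Rightarrow> real) \<Rightarrow> bool" where
  "gaussian_family N I X R \<longleftrightarrow> prob_space N \<and> finite I \<and>
     (\<forall>i\<in>I. X i \<in> borel_measurable N) \<and> (\<forall>i\<in>I. \<forall>j\<in>I. R i j = R j i) \<and>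
     (\<forall>v. joint_char N I X v = complex_of_real (exp (- (\<Sum>i\<in>I. \<Sum>j\<in>I. v i * v j * R i j) / 2)))"

lemma gaussian_familyD:
  assumes "gaussian_family N I X R"
  shows "prob_space N" "finite I" "\<And>i. i \<in> I \<Longrightarrow> X i \<in> borel_measurable N"
    "\<And>i j. i \<in> I \<Longrightarrow> j \<in> I \<Longrightarrow> R i j = R j i"
    "\<And>v. joint_char N I X v = complex_of_real (exp (- (\<Sum>i\<in>I. \<Sum>j\<in>I. v i * v j * R i j) / 2))"
  using assms unfolding gaussian_family_def by blast+

text \<open>The characteristic function of the image at \<open>v\<close> is that of \<open>X\<close>
  at the transposed image of \<open>v\<close>; the rest is the exchange of sums that shows the
  covariance to be \<open>A R A^T\<close>.\<close>

lemma gaussian_family_linear: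
  assumes g: "gaussian_family N I X R" and J: "finite J"
  shows "gaussian_family N J (\<lambda>j \<omega>. \<Sum>i\<in>I. A j i * X i \<omega>)
           (\<lambda>j k. \<Sum>i\<in>I. \<Sum>i'\<in>I. A j i * A k i' * R i i')"
  unfolding gaussian_family_def
proof (intro conjI ballI allI)
  note D = gaussian_familyD[OF g]
  show "prob_space N" "finite J" using D J by auto
  show "(\<lambda>\<omega>. \<Sum>i\<in>I. A j i * X i \<omega>) \<in> borel_measurable N" for j
    using D(3) by simp
  show "(\<Sum>i\<in>I. \<Sum>i'\<in>I. A j i * A k i' * R i i') = (\<Sum>i\<in>I. \<Sum>i'\<in>I. A k i * A j i' * R i i')" for j k
    by (subst sum.swap) (intro sum.cong refl, simp add: D(4) ac_simps)
  fix v
  have "(\<Sum>j\<in>J. v j * (\<Sum>i\<in>I. A j i * X i \<omega>)) = (\<Sum>i\<in>I. (\<Sum>j\<in>J. v j * A j i) * X i \<omega>)" for \<omega>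
    by (simp add: sum_distrib_left sum_distrib_right) (subst sum.swap, simp add: ac_simps)
  then have "joint_char N J (\<lambda>j \<omega>. \<Sum>i\<in>I. A j i * X i \<omega>) v = joint_char N I X (\<lambda>i. \<Sum>j\<in>J. v j * A j i)"
    unfolding joint_char_def by presburger
  moreover have "(\<Sum>i\<in>I. \<Sum>i'\<in>I. (\<Sum>j\<in>J. v j * A j i) * (\<Sum>j\<in>J. v j * A j i') * R i i')
     = (\<Sum>j\<in>J. \<Sum>k\<in>J. v j * v k * (\<Sum>i\<in>I. \<Sum>i'\<in>I. A j i * A k i' * R i i'))"
  proof -
    have "(\<Sum>i\<in>I. \<Sum>i'\<in>I. (\<Sum>j\<in>J. v j * A j i) * (\<Sum>j\<in>J. v j * A j i') * R i i')
       = (\<Sum>i\<in>I. \<Sum>i'\<in>I. \<Sum>j\<in>J. \<Sum>k\<in>J. v j * v k * (A j i * A k i' * R i i'))"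
      by (intro sum.cong refl) (simp only: sum_product, simp only: sum_distrib_right, intro sum.cong refl, simp add: ac_simps)
    also have "\<dots> = (\<Sum>i\<in>I. \<Sum>j\<in>J. \<Sum>i'\<in>I. \<Sum>k\<in>J. v j * v k * (A j i * A k i' * R i i'))"
      by (intro sum.cong refl, rule sum.swap)
    also have "\<dots> = (\<Sum>i\<in>I. \<Sum>j\<in>J. \<Sum>k\<in>J. \<Sum>i'\<in>I. v j * v k * (A j i * A k i' * R i i'))"
      by (intro sum.cong refl, rule sum.swap)
    also have "\<dots> = (\<Sum>j\<in>J. \<Sum>i\<in>I. \<Sum>k\<in>J. \<Sum>i'\<in>I. v j * v k * (A j i * A k i' * R i i'))"
      by (rule sum.swap)
    also have "\<dots> = (\<Sum>j\<in>J. \<Sum>k\<in>J. \<Sum>i\<in>I. \<Sum>i'\<in>I. v j * v k * (A j i * A k i' * R i i'))"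
      by (intro sum.cong refl, rule sum.swap)
    finally show ?thesis by (simp add: sum_distrib_left)
  qed
  ultimately show "joint_char N J (\<lambda>j \<omega>. \<Sum>i\<in>I. A j i * X i \<omega>) v = complex_of_real
     (exp (- (\<Sum>j\<in>J. \<Sum>k\<in>J. v j * v k * (\<Sum>i\<in>I. \<Sum>i'\<in>I. A j i * A k i' * R i i')) / 2))"
    by (simp only: D(5))
qed

lemma gaussian_family_box_eq:
  assumes "gaussian_family M I X R" "gaussian_family N I Y R'"
    and "\<And>i j. i \<in> I \<Longrightarrow> j \<in> I \<Longrightarrow> R i j = R' i j"
    and "\<And>i. i \<in> I \<Longrightarrow> B i \<in> sets borel"
  shows "measure M {\<omega> \<in> space M. \<forall>i\<in>I. X i \<omega> \<in> B i} = measure N {\<omega> \<in> space N. \<forall>i\<in>I. Y i \<omega> \<in> B i}"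
proof (rule cramer_wold)
  note D = gaussian_familyD[OF assms(1)] and E = gaussian_familyD[OF assms(2)]
  show "joint_char M I X v = joint_char N I Y v" for v
    unfolding D(5) E(5) using assms(3) by simp
qed (use gaussian_familyD[OF assms(1)] gaussian_familyD[OF assms(2)] assms(4) in auto)

text \<open>Isolates the dependence on the coefficient \<open>c\<close> of one coordinate: the three
  terms are the variance of the remaining combination, twice \<open>c\<close> times its covariance
  with coordinate \<open>k\<close>, and \<open>c\<close> squared times the variance of coordinate
  \<open>k\<close>.\<close>

lemma quadratic_form_update:
  fixes R :: "'i \<Rightarrow> 'i \<Rightarrow> real"
  assumes K: "finite K" "k \<in> K" and sym: "\<And>i j. i \<in> K \<Longrightarrow> j \<in> K \<Longrightarrow> R i j = R j i"
  shows "(\<Sum>i\<in>K. \<Sum>j\<in>K. (v(k := c)) i * (v(k := c)) j * R i j) =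
    (\<Sum>i\<in>K-{k}. \<Sum>j\<in>K-{k}. v i * v j * R i j) + 2 * c * (\<Sum>i\<in>K-{k}. v i * R i k) + c\<^sup>2 * R k k"
proof -
  have s: "sum f K = f k + sum f (K - {k})" for f :: "'i \<Rightarrow> real"
    using K by (simp add: sum.remove)
  have "(\<Sum>i\<in>K. \<Sum>j\<in>K. (v(k := c)) i * (v(k := c)) j * R i j)
     = (c * c * R k k + (\<Sum>j\<in>K-{k}. c * v j * R k j)) + (\<Sum>i\<in>K-{k}. v i * c * R i k + (\<Sum>j\<in>K-{k}. v i * v j * R i j))"
    by (subst (1 2) s, subst s) simp
  moreover have "(\<Sum>j\<in>K-{k}. c * v j * R k j) = c * (\<Sum>i\<in>K-{k}. v i * R i k)"
    unfolding sum_distrib_left by (intro sum.cong refl) (use sym K in auto)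
  moreover have "(\<Sum>i\<in>K-{k}. v i * c * R i k) = c * (\<Sum>i\<in>K-{k}. v i * R i k)"
    unfolding sum_distrib_left by (intro sum.cong refl) auto
  ultimately show ?thesis by (simp add: sum.distrib power2_eq_square)
qed

text \<open>Cauchy-Schwarz read off from the characteristic function: its modulus is at most 1, so
  the quadratic form at the coefficients 1 for \<open>k\<close> and -1 for \<open>l\<close>, which
  is \<open>2 - 2 * R l k\<close>, cannot be negative.\<close>

lemma gaussian_family_covariance_le:
  assumes g: "gaussian_family N K X R" and kl: "k \<in> K" "l \<in> K" "R k k = 1" "R l l = 1"
  shows "R l k \<le> 1"
proof (cases "k = l")
  case False
  note D = gaussian_familyD[OF g]
  interpret prob_space N by (rule D)
  define v where "v = (\<lambda>i. if i = l then -1 else 0 :: real)"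
  have e: "(\<Sum>i\<in>K. \<Sum>j\<in>K. (v(k := 1)) i * (v(k := 1)) j * R i j) = 2 - 2 * R l k"
  proof -
    have fin: "finite (K - {k})" "l \<in> K - {k}" using D(2) kl False by auto
    have "(\<Sum>j\<in>K - {k}. v j * f j) = - f l" for f
      using fin by (simp add: v_def if_distrib[of "\<lambda>x. x * _"] cong: if_cong)
    moreover have "(\<Sum>i\<in>K-{k}. \<Sum>j\<in>K-{k}. v i * v j * R i j) = (\<Sum>i\<in>K-{k}. v i * (\<Sum>j\<in>K-{k}. v j * R i j))"
      by (simp add: sum_distrib_left ac_simps)
    ultimately show ?thesis
      by (subst quadratic_form_update[OF D(2) kl(1) D(4)]) (use kl in \<open>auto simp: sum_negf\<close>)
  qed
  have "norm (joint_char N K X (v(k := 1))) \<le> (\<integral>\<omega>. norm (iexp (\<Sum>i\<in>K. (v(k := 1)) i * X i \<omega>)) \<partial>N)"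
    unfolding joint_char_def by (rule integral_norm_bound)
  also have "\<dots> = 1" by (simp del: of_real_sum fun_upd_apply add: prob_space)
  finally have "exp (- (2 - 2 * R l k) / 2) \<le> 1" unfolding D(5) e by simp
  then show ?thesis by simp
qed (use kl in auto)

text \<open>The density at \<open>s + t\<close> is \<open>exp (- t * s - t\<^sup>2 / 2)\<close>
  times the density at \<open>s\<close>, and \<open>s \<le> b \<le> u\<close> on the interval. As
  \<open>G\<close> is up-closed, the shifted point stays in \<open>G\<close>.\<close>

lemma normal_shift_upset:
  fixes a b t u :: real
  assumes t: "0 \<le> t" and b: "b \<le> u" and G[measurable]: "G \<in> sets borel"
    and up: "\<And>x y. x \<in> G \<Longrightarrow> x \<le> y \<Longrightarrow> y \<in> G"
  shows "ennreal (exp (- t * u - t\<^sup>2 / 2)) * emeasure std_normal_distribution ({a<..b} \<inter> G)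
     \<le> emeasure std_normal_distribution ({a+t<..b+t} \<inter> G)"
proof -
  have "emeasure std_normal_distribution ({a+t<..b+t} \<inter> G) =
      (\<integral>\<^sup>+s. ennreal (std_normal_density s) * indicator ({a+t<..b+t} \<inter> G) s \<partial>lborel)"
    by (rule emeasure_density) auto
  also have "\<dots> = (\<integral>\<^sup>+s. ennreal (std_normal_density (t + 1 * s)) * indicator ({a+t<..b+t} \<inter> G) (t + 1 * s) \<partial>lborel)"
    by (subst nn_integral_real_affine[where c=1 and t=t]) auto
  also have "\<dots> \<ge> (\<integral>\<^sup>+s. ennreal (exp (- t * u - t\<^sup>2 / 2)) * (ennreal (std_normal_density s) * indicator ({a<..b} \<inter> G) s) \<partial>lborel)"
  proof (rule nn_integral_mono)
    fix s :: real
    show "ennreal (exp (- t * u - t\<^sup>2 / 2)) * (ennreal (std_normal_density s) * indicator ({a<..b} \<inter> G) s)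
        \<le> ennreal (std_normal_density (t + 1 * s)) * indicator ({a+t<..b+t} \<inter> G) (t + 1 * s)"
    proof (cases "s \<in> {a<..b} \<inter> G")
      case True
      then have "t + 1 * s \<in> {a+t<..b+t} \<inter> G" using up[of s "t + s"] t by auto
      moreover have "exp (- t * u - t\<^sup>2 / 2) * std_normal_density s \<le> std_normal_density (t + 1 * s)"
      proof -
        have "t * s \<le> t * u" using True b t by (intro mult_left_mono) auto
        then have "(- t * u - t\<^sup>2 / 2) + (- s\<^sup>2 / 2) \<le> - (t + 1 * s)\<^sup>2 / 2"
          by (simp add: power2_eq_square field_simps)
        then have "exp (- t * u - t\<^sup>2 / 2) * exp (- s\<^sup>2 / 2) \<le> exp (- (t + 1 * s)\<^sup>2 / 2)"
          unfolding exp_add[symmetric] by simp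
        then show ?thesis unfolding std_normal_density_def
          by (simp add: divide_right_mono)
      qed
      ultimately show ?thesis using True by (simp add: ennreal_mult[symmetric])
    qed simp
  qed
  also have "(\<integral>\<^sup>+s. ennreal (exp (- t * u - t\<^sup>2 / 2)) * (ennreal (std_normal_density s) * indicator ({a<..b} \<inter> G) s) \<partial>lborel)
      = ennreal (exp (- t * u - t\<^sup>2 / 2)) * emeasure std_normal_distribution ({a<..b} \<inter> G)"
    by (subst nn_integral_cmult) (auto simp: emeasure_density)
  finally show ?thesis .
qed

text \<open>Conditionally on the part of the family that is independent of \<open>\<eta> k\<close>, the constraints say that
  \<open>\<eta> k\<close> lies in an up-closed set, because its covariances are at most its variance 1.\<close>
lemma gaussian_shift:
  fixes a b t u :: real
  assumes g: "gaussian_family N K \<eta> R" and k: "k \<in> K" and R1: "\<And>l. l \<in> K \<Longrightarrow> R l l = 1"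
    and B[measurable]: "\<And>l. l \<in> K - {k} \<Longrightarrow> B l \<in> sets borel"
    and down: "\<And>l x y. l \<in> K - {k} \<Longrightarrow> x \<in> B l \<Longrightarrow> y \<le> x \<Longrightarrow> y \<in> B l"
    and t: "0 \<le> t" and b: "b \<le> u"
  shows "exp (- t * u - t\<^sup>2 / 2) * measure N {\<omega> \<in> space N. \<eta> k \<omega> \<in> {a<..b} \<and> (\<forall>l\<in>K-{k}. \<eta> l \<omega> - \<eta> k \<omega> \<in> B l)}
     \<le> measure N {\<omega> \<in> space N. \<eta> k \<omega> \<in> {a+t<..b+t} \<and> (\<forall>l\<in>K-{k}. \<eta> l \<omega> - \<eta> k \<omega> \<in> B l)}"
proof -
  note D = gaussian_familyD[OF g]
  interpret N: prob_space N by (rule D)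
  let ?\<nu> = std_normal_distribution
  interpret \<nu>: real_distribution ?\<nu> by (rule real_dist_normal_dist)
  interpret P: pair_prob_space N ?\<nu> ..
  let ?P = "N \<Otimes>\<^sub>M ?\<nu>"
  have PP: "prob_space ?P" by (rule P.prob_space_axioms)
  note [measurable] = D(3)[OF k]
  have [measurable]: "\<eta> l \<in> borel_measurable N" if "l \<in> K" for l using D(3) that .
  have [measurable]: "\<eta> l \<in> borel_measurable N" "B l \<in> sets borel" if "l \<in> K - {k}" for l using D(3) B that by auto
  \<comment> \<open>In the coordinates \<open>U\<close> the event is a box. For \<open>U'\<close>,
    regression on \<open>\<eta> k\<close> splits \<open>\<eta> l\<close> into the residual
    \<open>\<eta> l - R l k * \<eta> k\<close>, which is uncorrelated with \<open>\<eta> k\<close>,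
    and a multiple of \<open>\<eta> k\<close>; each \<open>\<eta> k\<close> outside the residual is
    then replaced by the independent standard normal \<open>snd z\<close>.\<close>
  define U where "U l \<omega> = (if l = k then \<eta> k \<omega> else \<eta> l \<omega> - \<eta> k \<omega>)" for l \<omega>
  define U' where "U' l z = (if l = k then snd z else \<eta> l (fst z) - R l k * \<eta> k (fst z) + (R l k - 1) * snd z)" for l and z :: "'a \<times> real"
  have [measurable]: "U l \<in> borel_measurable N" if "l \<in> K" for l
    using that unfolding U_def by measurable
  have [measurable]: "U' l \<in> borel_measurable ?P" if "l \<in> K" for l
    using that unfolding U'_def by measurable
  have sK: "sum f K = f k + sum f (K - {k})" for f :: "'b \<Rightarrow> real"
    using D(2) k by (simp add: sum.remove)
  have jc: "joint_char N K U v = joint_char ?P K U' v" for v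
  proof -
    \<comment> \<open>Rewritten in terms of \<open>\<eta>\<close>, the combination of the
      \<open>U l\<close> has coefficient \<open>x\<close> at \<open>\<eta> k\<close>;
      \<open>q\<close> is the variance of the remaining sum and \<open>m\<close> its covariance with
      \<open>\<eta> k\<close>.\<close>
    define x where "x = v k - (\<Sum>l\<in>K-{k}. v l)"
    define m where "m = (\<Sum>l\<in>K-{k}. v l * R l k)"
    define q where "q = (\<Sum>i\<in>K-{k}. \<Sum>j\<in>K-{k}. v i * v j * R i j)"
    have Q: "(\<Sum>i\<in>K. \<Sum>j\<in>K. (v(k := c)) i * (v(k := c)) j * R i j) = q + 2 * c * m + c\<^sup>2" for c
      using quadratic_form_update[where R=R and v=v and c=c, OF D(2) k D(4)] R1[OF k] by (simp add: m_def q_def)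
    have "(\<Sum>l\<in>K. v l * U l \<omega>) = (\<Sum>l\<in>K. (v(k := x)) l * \<eta> l \<omega>)" for \<omega>
      unfolding sK by (simp add: U_def x_def right_diff_distrib sum_subtractf left_diff_distrib sum_distrib_right)
    then have "joint_char N K U v = joint_char N K \<eta> (v(k := x))" unfolding joint_char_def by presburger
    then have L: "joint_char N K U v = complex_of_real (exp (- (q + 2 * x * m + x\<^sup>2) / 2))"
      unfolding D(5) Q .
    have e: "(\<Sum>l\<in>K. v l * U' l (\<omega>, s)) = (\<Sum>l\<in>K. (v(k := -m)) l * \<eta> l \<omega>) + (x + m) * s" for \<omega> s
    proof -
      have "(\<Sum>l\<in>K-{k}. v l * U' l (\<omega>, s)) = (\<Sum>l\<in>K-{k}. v l * \<eta> l \<omega> - v l * R l k * \<eta> k \<omega> + (v l * R l k) * s - v l * s)"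
        by (intro sum.cong refl) (auto simp: U'_def algebra_simps)
      also have "\<dots> = (\<Sum>l\<in>K-{k}. v l * \<eta> l \<omega>) - m * \<eta> k \<omega> + m * s - (\<Sum>l\<in>K-{k}. v l) * s"
        by (simp add: m_def sum.distrib sum_subtractf sum_distrib_right)
      finally show ?thesis unfolding sK x_def by (simp add: U'_def algebra_simps)
    qed
    have int: "integrable ?P (\<lambda>z. iexp (\<Sum>l\<in>K. v l * U' l z))"
      by (rule P.integrable_iexp) auto
    have "joint_char ?P K U' v = (CLINT \<omega>|N. CLINT s|?\<nu>. iexp (\<Sum>l\<in>K. v l * U' l (\<omega>, s)))"
      unfolding joint_char_def by (rule P.integral_fst'[OF int, symmetric])
    also have "\<dots> = (CLINT \<omega>|N. CLINT s|?\<nu>. iexp (\<Sum>l\<in>K. (v(k := -m)) l * \<eta> l \<omega>) * iexp ((x + m) * s))"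
      unfolding e of_real_add distrib_left exp_add ..
    also have "\<dots> = (CLINT \<omega>|N. iexp (\<Sum>l\<in>K. (v(k := -m)) l * \<eta> l \<omega>) * char ?\<nu> (x + m))"
      unfolding char_def by (simp only: integral_mult_right_zero)
    also have "\<dots> = joint_char N K \<eta> (v(k := -m)) * char ?\<nu> (x + m)"
      unfolding joint_char_def by (simp only: integral_mult_left_zero)
    \<comment> \<open>Completing the square: the residual variance \<open>q - m\<^sup>2\<close> and
      the contribution \<open>(x + m)\<^sup>2\<close> of the independent normal add up to
      \<open>q + 2 * x * m + x\<^sup>2\<close>.\<close>
    also have "\<dots> = complex_of_real (exp (- (q + 2 * (-m) * m + (-m)\<^sup>2) / 2) * exp (- (x + m)\<^sup>2 / 2))"
      unfolding D(5) Q by (simp add: char_std_normal_distribution)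
    also have "\<dots> = complex_of_real (exp (- (q + 2 * x * m + x\<^sup>2) / 2))"
      unfolding exp_add[symmetric] by (rule arg_cong[of _ _ "\<lambda>x. complex_of_real (exp x)"]) (simp add: power2_eq_square field_simps)
    finally show ?thesis using L by simp
  qed
  define G where "G \<omega> = {s. \<forall>l\<in>K-{k}. \<eta> l \<omega> - R l k * \<eta> k \<omega> + (R l k - 1) * s \<in> B l}" for \<omega>
  have finK: "finite (K - {k})" using D(2) by auto
  have Gm: "G \<omega> \<in> sets borel" for \<omega>
  proof -
    have "{s \<in> space borel. \<forall>l\<in>K-{k}. \<eta> l \<omega> - R l k * \<eta> k \<omega> + (R l k - 1) * s \<in> B l} \<in> sets borel"
      using finK by measurable
    then show ?thesis by (simp add: G_def)
  qed
  have Gup: "y \<in> G \<omega>" if "x \<in> G \<omega>" "x \<le> y" for x y \<omega>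
    unfolding G_def
  proof (intro CollectI ballI)
    fix l assume l: "l \<in> K - {k}"
    have "(R l k - 1) * y \<le> (R l k - 1) * x"
      using gaussian_family_covariance_le[OF g k, of l] R1 l k that(2) by (intro mult_left_mono_neg) auto
    moreover have "\<eta> l \<omega> - R l k * \<eta> k \<omega> + (R l k - 1) * x \<in> B l"
      using that(1) l by (auto simp: G_def)
    ultimately show "\<eta> l \<omega> - R l k * \<eta> k \<omega> + (R l k - 1) * y \<in> B l"
      using down[OF l] by (metis add_left_mono)
  qed
  \<comment> \<open>Fubini on the product space: for fixed \<open>\<omega>\<close> the event is an
    interval intersected with the up-closed set \<open>G \<omega>\<close>, so the shift can be
    estimated slice by slice.\<close>
  have main: "emeasure N {\<omega> \<in> space N. \<eta> k \<omega> \<in> {a<..b} \<and> (\<forall>l\<in>K-{k}. \<eta> l \<omega> - \<eta> k \<omega> \<in> B l)}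
     = (\<integral>\<^sup>+\<omega>. emeasure ?\<nu> ({a<..b} \<inter> G \<omega>) \<partial>N)"
    and Gmeas: "(\<lambda>\<omega>. emeasure ?\<nu> ({a<..b} \<inter> G \<omega>)) \<in> borel_measurable N" for a b :: real
  proof -
    define B' where "B' l = (if l = k then {a<..b} else B l)" for l
    have B'm: "B' l \<in> sets borel" if "l \<in> K" for l using that by (auto simp: B'_def)
    have e1: "{\<omega> \<in> space N. \<eta> k \<omega> \<in> {a<..b} \<and> (\<forall>l\<in>K-{k}. \<eta> l \<omega> - \<eta> k \<omega> \<in> B l)} = {\<omega> \<in> space N. \<forall>l\<in>K. U l \<omega> \<in> B' l}"
      using k by (auto simp: U_def B'_def)
    let ?A = "{z \<in> space ?P. \<forall>l\<in>K. U' l z \<in> B' l}"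
    have Am: "?A \<in> sets ?P" using D(2) B'm by measurable
    have slice: "Pair \<omega> -` ?A = {a<..b} \<inter> G \<omega>" if "\<omega> \<in> space N" for \<omega>
      using that k by (auto simp: G_def U'_def B'_def space_pair_measure split: if_splits)
    have "measure N {\<omega> \<in> space N. \<forall>l\<in>K. U l \<omega> \<in> B' l} = measure ?P ?A"
      by (rule cramer_wold[OF D(1) PP D(2)]) (use jc B'm in auto)
    then have "emeasure N {\<omega> \<in> space N. \<forall>l\<in>K. U l \<omega> \<in> B' l} = emeasure ?P ?A"
      by (simp add: N.emeasure_eq_measure P.emeasure_eq_measure)
    also have "\<dots> = (\<integral>\<^sup>+\<omega>. emeasure ?\<nu> (Pair \<omega> -` ?A) \<partial>N)"
      by (rule \<nu>.emeasure_pair_measure_alt[OF Am])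
    also have "\<dots> = (\<integral>\<^sup>+\<omega>. emeasure ?\<nu> ({a<..b} \<inter> G \<omega>) \<partial>N)"
      by (intro nn_integral_cong) (simp only: slice)
    finally show "emeasure N {\<omega> \<in> space N. \<eta> k \<omega> \<in> {a<..b} \<and> (\<forall>l\<in>K-{k}. \<eta> l \<omega> - \<eta> k \<omega> \<in> B l)}
      = (\<integral>\<^sup>+\<omega>. emeasure ?\<nu> ({a<..b} \<inter> G \<omega>) \<partial>N)" unfolding e1 .
    show "(\<lambda>\<omega>. emeasure ?\<nu> ({a<..b} \<inter> G \<omega>)) \<in> borel_measurable N"
      using \<nu>.measurable_emeasure_Pair[OF Am] by (rule subst[OF measurable_cong, rotated]) (simp only: slice)
  qed
  have "ennreal (exp (- t * u - t\<^sup>2 / 2)) * (\<integral>\<^sup>+\<omega>. emeasure ?\<nu> ({a<..b} \<inter> G \<omega>) \<partial>N)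
      = (\<integral>\<^sup>+\<omega>. ennreal (exp (- t * u - t\<^sup>2 / 2)) * emeasure ?\<nu> ({a<..b} \<inter> G \<omega>) \<partial>N)"
    by (rule nn_integral_cmult[OF Gmeas, symmetric])
  also have "\<dots> \<le> (\<integral>\<^sup>+\<omega>. emeasure ?\<nu> ({a+t<..b+t} \<inter> G \<omega>) \<partial>N)"
    by (intro nn_integral_mono normal_shift_upset[OF t b Gm]) (rule Gup)
  finally show ?thesis
    unfolding main[symmetric] by (simp add: N.emeasure_eq_measure ennreal_mult[symmetric])
qed

text \<open>The bound does not depend on the number of variables: each of the \<open>m\<close> translates of the
  level set \<open>- 1 / m < V \<le> 0\<close> of \<open>V = Max (\<eta> k - c k)\<close> is at least \<open>exp (- u - 1 / 2)\<close> times as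
  likely, and the translates are disjoint.\<close>
theorem gaussian_max_anticoncentration:
  fixes c :: "'i \<Rightarrow> real"
  assumes g: "gaussian_family N K \<eta> R" and R1: "\<And>l. l \<in> K \<Longrightarrow> R l l = 1"
    and c: "\<And>l. l \<in> K \<Longrightarrow> c l \<le> u" and u: "0 \<le> u" and m: "0 < m"
  shows "measure N {\<omega> \<in> space N. (\<exists>k\<in>K. c k - 1 / real m < \<eta> k \<omega>) \<and> (\<forall>k\<in>K. \<eta> k \<omega> \<le> c k)} \<le> exp (u + 1/2) / m"
proof -
  note D = gaussian_familyD[OF g]
  interpret prob_space N by (rule D)
  note [measurable] = D(3)
  \<comment> \<open>An injective numbering that breaks ties between maximizers; it makes the events
    for different \<open>k\<close> disjoint.\<close>
  obtain idx :: "'i \<Rightarrow> nat" where idx: "inj_on idx K"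
    using finite_imp_inj_to_nat_seg[OF D(2)] by blast
  \<comment> \<open>Having all \<open>\<eta> l \<omega> - \<eta> k \<omega>\<close> in
    \<open>B k l\<close> means that \<open>k\<close> maximizes
    \<open>\<eta> l \<omega> - c l\<close> and comes first among the maximizers. Only differences
    and down-closed sets are involved, as \<open>gaussian_shift\<close> requires.\<close>
  define B where "B k l = (if idx l < idx k then {..<c l - c k} else {..c l - c k})" for k l
  \<comment> \<open>The maximum is attained at \<open>k\<close> and lies in the cell number
    \<open>i\<close> of width \<open>1 / m\<close>, counted from \<open>- 1 / m\<close>; the cells
    with \<open>i = 0\<close> cover the event to be bounded.\<close>
  define E where "E k i = {\<omega> \<in> space N. \<eta> k \<omega> \<in> {c k - 1 / m + real i / m<..c k + real i / m} \<and> (\<forall>l\<in>K-{k}. \<eta> l \<omega> - \<eta> k \<omega> \<in> B k l)}" for k i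
  have [measurable]: "B k l \<in> sets borel" for k l by (auto simp: B_def)
  have finK: "finite (K - {k})" for k using D(2) by auto
  have Em[measurable]: "E k i \<in> sets N" if "k \<in> K" for k i
  proof -
    have [measurable]: "\<eta> l \<in> borel_measurable N" if "l \<in> K - {k}" for l using D(3) that by auto
    note [measurable] = D(3)[OF that]
    show ?thesis unfolding E_def using finK by measurable
  qed
  let ?S = "{\<omega> \<in> space N. (\<exists>k\<in>K. c k - 1 / real m < \<eta> k \<omega>) \<and> (\<forall>k\<in>K. \<eta> k \<omega> \<le> c k)}"
  have lower: "exp (- u - 1/2) * measure N (E k 0) \<le> measure N (E k i)" if k: "k \<in> K" and i: "i < m" for k i
  proof -
    \<comment> \<open>Origin of the constant: the shifts \<open>i / m\<close> never exceed 1, so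
      with \<open>u \<ge> 0\<close> the loss is at worst \<open>exp (- u - 1/2)\<close>, whatever
      \<open>i\<close> and \<open>m\<close>.\<close>
    have t: "0 \<le> real i / m" "real i / m \<le> 1" using i by auto
    have "exp (- u - 1/2) * measure N (E k 0) \<le> exp (- (real i / m) * u - (real i / m)\<^sup>2 / 2) * measure N (E k 0)"
    proof (intro mult_right_mono)
      have "(real i / m) * u \<le> 1 * u" "(real i / m)\<^sup>2 \<le> 1" using t u by (intro mult_right_mono power_le_one; auto)+
      then show "exp (- u - 1/2) \<le> exp (- (real i / m) * u - (real i / m)\<^sup>2 / 2)" by simp
    qed simp
    also have "\<dots> \<le> measure N (E k i)"
    proof -
      have down: "y \<in> B k l" if "x \<in> B k l" "y \<le> x" for l x y
        using that by (auto simp: B_def split: if_splits)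
      have "exp (- (real i / m) * u - (real i / m)\<^sup>2 / 2) *
          measure N {\<omega> \<in> space N. \<eta> k \<omega> \<in> {c k - 1 / m<..c k} \<and> (\<forall>l\<in>K-{k}. \<eta> l \<omega> - \<eta> k \<omega> \<in> B k l)}
        \<le> measure N {\<omega> \<in> space N. \<eta> k \<omega> \<in> {c k - 1 / m + real i / m<..c k + real i / m} \<and> (\<forall>l\<in>K-{k}. \<eta> l \<omega> - \<eta> k \<omega> \<in> B k l)}"
        by (rule gaussian_shift[where R=R, OF g k R1 _ down t(1) c[OF k]]) (measurable)
      then show ?thesis by (simp add: E_def)
    qed
    finally show ?thesis .
  qed
  have cover: "?S \<subseteq> (\<Union>k\<in>K. E k 0)"
  proof
    fix \<omega> assume w: "\<omega> \<in> ?S"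
    let ?V = "\<lambda>k. \<eta> k \<omega> - c k"
    have ne: "finite (?V ` K)" "?V ` K \<noteq> {}" using w D(2) by auto
    let ?T = "{k \<in> K. ?V k = Max (?V ` K)}"
    have T: "finite ?T" "?T \<noteq> {}" using D(2) Max_in[OF ne] by auto
    define k where "k = arg_min_on idx ?T"
    have kT: "k \<in> ?T" using arg_min_if_finite(1)[OF T, of idx] unfolding k_def .
    have kmin: "\<not> idx l < idx k" if "l \<in> ?T" for l using arg_min_if_finite(2)[OF T, of idx] that unfolding k_def by blast
    have kge: "?V l \<le> ?V k" if "l \<in> K" for l using kT Max_ge[OF ne(1)] that by auto
    have "\<eta> l \<omega> - \<eta> k \<omega> \<in> B k l" if l: "l \<in> K - {k}" for l
    proof (cases "idx l < idx k")
      case True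
      then have "l \<notin> ?T" using kmin by blast
      then have "?V l \<noteq> ?V k" using kT l by auto
      then show ?thesis using kge[of l] l True by (auto simp: B_def)
    qed (use kge[of l] l in \<open>auto simp: B_def\<close>)
    moreover obtain k' where "k' \<in> K" "c k' - 1 / real m < \<eta> k' \<omega>" using w by blast
    then have "c k - 1 / m < \<eta> k \<omega>" using kge[of k'] by linarith
    ultimately have "\<omega> \<in> E k 0" using w kT by (auto simp: E_def)
    then show "\<omega> \<in> (\<Union>k\<in>K. E k 0)" using kT by blast
  qed
  have disj: "disjoint_family_on (\<lambda>(k, i). E k i) (K \<times> {..<m})"
    unfolding disjoint_family_on_def
  proof (intro ballI impI, rule ccontr)
    fix z z' assume z: "z \<in> K \<times> {..<m}" "z' \<in> K \<times> {..<m}" "z \<noteq> z'"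
      and ne: "(case z of (k, i) \<Rightarrow> E k i) \<inter> (case z' of (k, i) \<Rightarrow> E k i) \<noteq> {}"
    obtain k i k' i' where zz: "z = (k, i)" "z' = (k', i')" by (cases z, cases z')
    then obtain \<omega> where w: "\<omega> \<in> E k i" "\<omega> \<in> E k' i'" using ne by auto
    have kK: "k \<in> K" "k' \<in> K" using z zz by auto
    have contra: "\<not> idx k < idx k'" if "k \<in> K" "k' \<in> K" "\<omega> \<in> E k i" "\<omega> \<in> E k' i'" for k k' i i'
    proof
      assume lt: "idx k < idx k'"
      then have "k' \<in> K - {k}" "k \<in> K - {k'}" using that by auto
      then have "\<eta> k' \<omega> - \<eta> k \<omega> \<in> B k k'" "\<eta> k \<omega> - \<eta> k' \<omega> \<in> B k' k" using that by (auto simp: E_def)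
      then show False using lt by (auto simp: B_def)
    qed
    have "idx k = idx k'" using contra[OF kK w] contra[OF kK(2,1) w(2,1)] by simp
    then have kk: "k = k'" using idx kK by (auto dest: inj_onD)
    have contra': "\<not> i < i'" if "\<omega> \<in> E k i" "\<omega> \<in> E k i'" for i i'
    proof
      assume "i < i'"
      have "c k - 1 / m + real i' / m < c k + real i / m" using that(1,2) by (auto simp: E_def)
      then have "(real i' - 1) / m < real i / m" by (simp add: diff_divide_distrib)
      then have "real i' - 1 < real i" using m by (simp add: divide_less_cancel)
      then show False using \<open>i < i'\<close> by linarith
    qed
    have "i = i'" using contra'[of i i'] contra'[of i' i] w kk by auto
    then show False using z(3) zz kk by simp
  qed
  \<comment> \<open>Each \<open>E k 0\<close> is counted \<open>m\<close> times, once per cell,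
    against disjoint events of total probability at most 1.\<close>
  have "m * (exp (- u - 1/2) * measure N ?S) \<le> m * (exp (- u - 1/2) * (\<Sum>k\<in>K. measure N (E k 0)))"
  proof (intro mult_left_mono)
    have "measure N ?S \<le> measure N (\<Union>k\<in>K. E k 0)"
      by (rule finite_measure_mono[OF cover]) (use D(2) Em in auto)
    also have "\<dots> \<le> (\<Sum>k\<in>K. measure N (E k 0))"
      by (rule finite_measure_subadditive_finite) (use D(2) Em in auto)
    finally show "measure N ?S \<le> (\<Sum>k\<in>K. measure N (E k 0))" .
  qed auto
  also have "\<dots> = (\<Sum>k\<in>K. \<Sum>i<m. exp (- u - 1/2) * measure N (E k 0))"
    by (simp add: sum_distrib_left)
  also have "\<dots> \<le> (\<Sum>k\<in>K. \<Sum>i<m. measure N (E k i))"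
    by (intro sum_mono lower) auto
  also have "\<dots> = (\<Sum>(k, i)\<in>K \<times> {..<m}. measure N (E k i))"
    by (rule sum.cartesian_product)
  also have "\<dots> = measure N (\<Union>z\<in>K \<times> {..<m}. (\<lambda>(k, i). E k i) z)"
    by (subst finite_measure_finite_Union[OF _ _ disj]) (use D(2) Em in \<open>auto simp: case_prod_beta\<close>)
  also have "\<dots> \<le> 1" by (rule prob_le_1)
  finally have le: "m * (exp (- u - 1/2) * measure N ?S) \<le> 1" .
  have "exp (u + 1/2) * exp (- u - 1/2) = 1" unfolding exp_add[symmetric] by simp
  moreover have "a * (x * (b * y)) = (a * b) * (x * y)" for a b x y :: real by simp
  ultimately have "m * measure N ?S = exp (u + 1/2) * (m * (exp (- u - 1/2) * measure N ?S))"
    by simp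
  also have "\<dots> \<le> exp (u + 1/2) * 1"
    by (rule mult_left_mono[OF le]) simp
  finally have "m * measure N ?S \<le> exp (u + 1/2)" by simp
  then show ?thesis using m by (simp add: field_simps)
qed

subsection \<open>Pseudo-inverses and orthogonal projections\<close>

text \<open>The side conditions are equations between dimensions, which the simplifier can discharge
  while it reassociates long products.\<close>

lemma mult_mat_assoc_dim:
  fixes A B C :: "'a :: semiring_0 mat"
  assumes "dim_col A = dim_row B" "dim_col B = dim_row C"
  shows "A * B * C = A * (B * C)"
  using assms by (intro assoc_mult_mat[of _ "dim_row A" "dim_col A" _ "dim_col B" _ "dim_col C"]) auto

lemma transpose_mult_dim:
  fixes A B :: "'a :: comm_semiring_0 mat"
  assumes "dim_col A = dim_row B"
  shows "transpose_mat (A * B) = transpose_mat B * transpose_mat A"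
  using assms by (intro transpose_mult[of _ "dim_row A" "dim_col A" _ "dim_col B"]) auto

text \<open>The row echelon form \<open>C = P * A\<close> contains a unit vector in each pivot
  column. A matrix \<open>H\<close> that selects these columns satisfies
  \<open>C * H * C = C\<close>, and undoing the row operations shows that \<open>H * P\<close> is an
  inner inverse of \<open>A\<close>.\<close>

lemma exists_inner_inverse:
  fixes A :: "'a :: field mat"
  assumes A: "A \<in> carrier_mat nr nc"
  shows "\<exists>G\<in>carrier_mat nc nr. A * G * A = A"
proof -
  define C where "C = gauss_jordan_single A"
  note gj = gauss_jordan_single[OF A C_def[symmetric]]
  obtain P Q where PQ: "C = P * A" "P \<in> carrier_mat nr nr" "Q \<in> carrier_mat nr nr" "Q * P = 1\<^sub>m nr"
    using gj(4) by blast
  obtain f where f: "pivot_fun C f nc" using gj(2,3) unfolding row_echelon_form_def by auto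
  have C: "C \<in> carrier_mat nr nc" by (rule gj(2))
  then have dC: "dim_row C = nr" "dim_col C = nc" by auto
  note piv = pivot_funD[OF dC(1) f]
  \<comment> \<open>A zero row \<open>i\<close> of \<open>C\<close> has \<open>f i = nc\<close>, so
    column \<open>i\<close> of \<open>H\<close> vanishes; hence \<open>C * H\<close> is the diagonal
    matrix that marks the nonzero rows of \<open>C\<close>.\<close>
  define H where "H = mat nc nr (\<lambda>(j, i). if j = f i then 1 else 0 :: 'a)"
  have H: "H \<in> carrier_mat nc nr" by (simp add: H_def)
  have CH: "(C * H) $$ (i, k) = (if i = k \<and> f i < nc then 1 else 0)" if "i < nr" "k < nr" for i k
  proof -
    have "(C * H) $$ (i, k) = (\<Sum>j\<in>{0..<nc}. C $$ (i, j) * (if j = f k then 1 else 0))"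
      using that C by (auto simp: H_def scalar_prod_def intro!: sum.cong)
    also have "\<dots> = (if f k < nc then C $$ (i, f k) else 0)"
      by (simp add: if_distrib[of "\<lambda>x. _ * x"] cong: if_cong)
    also have "\<dots> = (if i = k \<and> f i < nc then 1 else 0)"
      using piv(4)[OF that(2)] piv(5)[OF that(2) _ that(1)] by auto
    finally show ?thesis .
  qed
  have CHC: "C * H * C = C"
  proof (rule eq_matI)
    fix i j assume ij: "i < dim_row C" "j < dim_col C"
    have "(D * C) $$ (i, j) = (\<Sum>k\<in>{0..<nr}. D $$ (i, k) * C $$ (k, j))" if "D \<in> carrier_mat nr nr" for D
      using that ij C by (auto simp: scalar_prod_def intro!: sum.cong)
    then have "(C * H * C) $$ (i, j) = (\<Sum>k\<in>{0..<nr}. (C * H) $$ (i, k) * C $$ (k, j))"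
      using C H by (meson mult_carrier_mat)
    also have "\<dots> = (\<Sum>k\<in>{0..<nr}. if k = i then (if f i < nc then C $$ (i, j) else 0) else 0)"
      using ij dC by (intro sum.cong refl) (auto simp: CH)
    also have "\<dots> = (if f i < nc then C $$ (i, j) else 0)" using ij dC by simp
    also have "\<dots> = C $$ (i, j)"
      using piv(1)[of i] piv(2)[of i j] ij dC by auto
    finally show "(C * H * C) $$ (i, j) = C $$ (i, j)" .
  qed (use C H in auto)
  have QC: "Q * C = A"
    unfolding PQ(1) using PQ A by (simp flip: assoc_mult_mat[OF PQ(3,2) A])
  have dims: "dim_row A = nr" "dim_col A = nc" "dim_row H = nc" "dim_col H = nr" "dim_row P = nr"
    "dim_col P = nr" "dim_row Q = nr" "dim_col Q = nr" using A H PQ by auto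
  have "A * (H * P) * A = A * (H * C)"
    unfolding PQ(1) using dims by (simp add: mult_mat_assoc_dim)
  also have "\<dots> = Q * (C * H * C)"
    unfolding QC[symmetric] using dims dC by (simp add: mult_mat_assoc_dim)
  also have "\<dots> = A" unfolding CHC QC ..
  finally show ?thesis using H PQ(2) by (intro bexI[of _ "H * P"]) auto
qed

lemma scalar_prod_self_real:
  "scalar_prod v v = (\<Sum>i<dim_vec v. (v $ i)\<^sup>2)" for v :: "real vec"
  by (simp add: scalar_prod_def power2_eq_square atLeast0LessThan)

lemma scalar_prod_self_nonneg: "0 \<le> scalar_prod v v" for v :: "real vec"
  unfolding scalar_prod_self_real by (simp add: sum_nonneg)

lemma scalar_prod_self_eq_0:
  fixes v :: "real vec"
  assumes "v \<in> carrier_vec n"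
  shows "scalar_prod v v = 0 \<longleftrightarrow> v = 0\<^sub>v n"
  using assms unfolding scalar_prod_self_real by (subst sum_nonneg_eq_0_iff) auto

lemma transpose_mult_self_eq_0:
  fixes E :: "real mat"
  assumes E: "E \<in> carrier_mat nr nc" and 0: "transpose_mat E * E = 0\<^sub>m nc nc"
  shows "E = 0\<^sub>m nr nc"
proof (rule eq_matI)
  fix i j assume ij: "i < dim_row (0\<^sub>m nr nc :: real mat)" "j < dim_col (0\<^sub>m nr nc :: real mat)"
  have "scalar_prod (col E j) (col E j) = (transpose_mat E * E) $$ (j, j)"
    using ij E by simp
  then have "col E j = 0\<^sub>v nr"
    using scalar_prod_self_eq_0[of "col E j" nr] ij E 0 by auto
  then have "col E j $ i = 0" using ij by simp
  then show "E $$ (i, j) = 0\<^sub>m nr nc $$ (i, j)" using ij E by simp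
qed (use E in auto)

text \<open>\<open>A * G * A^T\<close> is the orthogonal projector onto the column space of
  \<open>A\<close>. The defect \<open>E = U * A - A\<close> satisfies \<open>A^T * E = 0\<close> by
  hypothesis, and since both parts of \<open>E\<close> start with a factor \<open>A\<close>, also
  \<open>E^T * E = 0\<close>, so \<open>E = 0\<close>. Then \<open>U^T = U * U^T\<close>, which is
  symmetric.\<close>

lemma gram_inner_inverse:
  fixes A :: "real mat"
  assumes A: "A \<in> carrier_mat n m" and G: "G \<in> carrier_mat m m"
    and GA: "transpose_mat A * A * G * (transpose_mat A * A) = transpose_mat A * A"
  shows "A * G * transpose_mat A * A = A"
    and "transpose_mat (A * G * transpose_mat A) = A * G * transpose_mat A"
proof -
  let ?T = "transpose_mat A"
  have dims: "dim_row A = n" "dim_col A = m" "dim_row G = m" "dim_col G = m" using A G by auto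
  define U where "U = A * G * ?T"
  have U: "U \<in> carrier_mat n n" using A G by (simp add: U_def)
  have TU: "?T * (U * A) = ?T * A"
    using GA dims by (simp add: U_def mult_mat_assoc_dim)
  define E where "E = U * A - A"
  have E: "E \<in> carrier_mat n m" unfolding E_def by (rule minus_carrier_mat[OF A])
  have TE: "?T * E = 0\<^sub>m m m"
    unfolding E_def by (subst mult_minus_distrib_mat[of _ m n]) (use A U TU in auto)
  have "transpose_mat E * E = 0\<^sub>m m m"
  proof -
    have "transpose_mat E * E = transpose_mat E * (U * A) - transpose_mat E * A"
      by (subst (2) E_def, rule mult_minus_distrib_mat[of _ m n]) (use E A U in auto)
    also have "transpose_mat E * A = transpose_mat (?T * E)"
      using A E by (simp add: transpose_mult_dim)
    also have "transpose_mat E * (U * A) = transpose_mat (?T * E) * (G * (?T * A))"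
      using dims E A by (simp add: transpose_mult_dim U_def mult_mat_assoc_dim)
    finally show ?thesis unfolding TE using A G by simp
  qed
  then have "E = 0\<^sub>m n m" by (rule transpose_mult_self_eq_0[OF E])
  then have UA: "U * A = A"
  proof (intro eq_matI)
    fix i j assume ij: "i < dim_row A" "j < dim_col A"
    then have "(U * A - A) $$ (i, j) = 0" using \<open>E = 0\<^sub>m n m\<close> dims by (simp add: E_def)
    then show "(U * A) $$ (i, j) = A $$ (i, j)" using ij U A by simp
  qed (use U A in auto)
  then show "A * G * ?T * A = A" by (simp add: U_def)
  have "transpose_mat U = U * transpose_mat U"
  proof -
    have "U * transpose_mat U = U * A * (transpose_mat G * ?T)"
      using dims by (simp add: U_def transpose_mult_dim mult_mat_assoc_dim)
    also have "\<dots> = transpose_mat U"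
      unfolding UA using dims by (simp add: U_def transpose_mult_dim mult_mat_assoc_dim)
    finally show ?thesis by simp
  qed
  moreover have "transpose_mat (U * transpose_mat U) = U * transpose_mat U"
    using U by (simp add: transpose_mult_dim)
  ultimately have "transpose_mat (transpose_mat U) = transpose_mat U" by metis
  then show "transpose_mat (A * G * ?T) = A * G * ?T" by (simp add: U_def)
qed

text \<open>\<open>A * B\<close> and \<open>A * C\<close> are orthogonal projectors onto the same
  column space and hence coincide; likewise \<open>B * A\<close> and \<open>C * A\<close>. Then
  \<open>B = B * A * B = B * A * C = C * A * C = C\<close>.\<close>

lemma penrose_unique:
  fixes A B C :: "real mat"
  assumes A: "A \<in> carrier_mat n m" and B: "B \<in> carrier_mat m n" and C: "C \<in> carrier_mat m n"
    and b: "A * B * A = A" "B * A * B = B" "transpose_mat (A * B) = A * B" "transpose_mat (B * A) = B * A"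
    and c: "A * C * A = A" "C * A * C = C" "transpose_mat (A * C) = A * C" "transpose_mat (C * A) = C * A"
  shows "B = C"
proof -
  have dims: "dim_row A = n" "dim_col A = m" "dim_row B = m" "dim_col B = n" "dim_row C = m" "dim_col C = n"
    using A B C by auto
  have "A * B = A * C * A * B" using c(1) by simp
  also have "\<dots> = (A * C) * (A * B)" using dims by (simp add: mult_mat_assoc_dim)
  also have "\<dots> = transpose_mat (A * C) * transpose_mat (A * B)" using b c by simp
  also have "\<dots> = transpose_mat (A * B * (A * C))" using dims by (simp add: transpose_mult_dim)
  also have "A * B * (A * C) = A * B * A * C" using dims by (simp add: mult_mat_assoc_dim)
  also have "transpose_mat \<dots> = A * C" using b c by simp
  finally have AB: "A * B = A * C" .
  have "B * A = B * (A * C * A)" using c(1) by simp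
  also have "\<dots> = (B * A) * (C * A)" using dims by (simp add: mult_mat_assoc_dim)
  also have "\<dots> = transpose_mat (B * A) * transpose_mat (C * A)" using b c by simp
  also have "\<dots> = transpose_mat (C * A * (B * A))" using dims by (simp add: transpose_mult_dim)
  also have "C * A * (B * A) = C * (A * B * A)" using dims by (simp add: mult_mat_assoc_dim)
  also have "transpose_mat \<dots> = C * A" using b c by simp
  finally have BA: "B * A = C * A" .
  have "B = B * (A * B)" using b(2) dims by (simp add: mult_mat_assoc_dim)
  also have "\<dots> = B * A * C" using AB dims by (simp add: mult_mat_assoc_dim)
  also have "\<dots> = C" unfolding BA by (rule c(2))
  finally show ?thesis .
qed

text \<open>\<open>pinv\<close> is a definite description, so the Penrose equations must be shown to
  have exactly one solution before anything can be read off from it.\<close>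

lemma pinv:
  fixes A :: "real mat"
  assumes A: "A \<in> carrier_mat n m"
  shows "pinv A \<in> carrier_mat m n" "A * pinv A * A = A"
proof -
  let ?T = "transpose_mat A"
  obtain G1 where G1: "G1 \<in> carrier_mat m m" "?T * A * G1 * (?T * A) = ?T * A"
    using exists_inner_inverse[of "?T * A" m m] A by auto
  obtain G2 where G2: "G2 \<in> carrier_mat n n" "A * ?T * G2 * (A * ?T) = A * ?T"
    using exists_inner_inverse[of "A * ?T" n n] A by auto
  note U = gram_inner_inverse[OF A G1]
  have "?T \<in> carrier_mat m n" using A by simp
  note V = gram_inner_inverse[OF this G2(1), unfolded transpose_transpose, OF G2(2)]
  have dims: "dim_row A = n" "dim_col A = m" "dim_row G1 = m" "dim_col G1 = m" "dim_row G2 = n" "dim_col G2 = n"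
    using A G1 G2 by auto
  \<comment> \<open>The product of the right factor \<open>A^T * G2\<close> and the projector
    \<open>A * G1 * A^T\<close>. It makes \<open>A * B\<close> and \<open>B * A\<close> the
    projectors onto the column space and the row space of \<open>A\<close>, so that both are
    symmetric.\<close>
  define B where "B = ?T * G2 * A * G1 * ?T"
  have AV: "A * (?T * G2 * A) = A"
  proof -
    have "A * (?T * G2 * A) = transpose_mat (transpose_mat (?T * G2 * A) * ?T)"
      using dims by (simp add: transpose_mult_dim mult_mat_assoc_dim)
    then show ?thesis unfolding V(2) V(1) by simp
  qed
  have AB: "A * B = A * G1 * ?T"
  proof -
    have "A * B = A * (?T * G2 * A) * (G1 * ?T)" using dims by (simp add: B_def mult_mat_assoc_dim)
    then show ?thesis unfolding AV using dims by (simp add: mult_mat_assoc_dim)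
  qed
  have BA: "B * A = ?T * G2 * A"
  proof -
    have "B * A = ?T * G2 * (A * G1 * ?T * A)" using dims by (simp add: B_def mult_mat_assoc_dim)
    then show ?thesis unfolding U(1) .
  qed
  have B: "B \<in> carrier_mat m n" by (intro carrier_matI) (simp_all add: B_def dims)
  have "B * A * B = B"
  proof -
    have "B * A * B = (?T * G2 * A * ?T) * (G2 * A * G1 * ?T)"
      unfolding BA using dims by (simp add: B_def mult_mat_assoc_dim)
    then show ?thesis unfolding V(1) using dims by (simp add: B_def mult_mat_assoc_dim)
  qed
  then have B_pen: "B \<in> carrier_mat (dim_col A) (dim_row A) \<and> A * B * A = A \<and> B * A * B = B \<and>
      transpose_mat (A * B) = A * B \<and> transpose_mat (B * A) = B * A"
    using B A U V unfolding AB BA by auto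
  have "pinv A = B"
    unfolding pinv_def
  proof (rule the_equality, rule B_pen)
    fix C assume C: "C \<in> carrier_mat (dim_col A) (dim_row A) \<and> A * C * A = A \<and> C * A * C = C \<and>
      transpose_mat (A * C) = A * C \<and> transpose_mat (C * A) = C * A"
    show "C = B"
      by (rule penrose_unique[OF A]) (use C B_pen A in auto)
  qed
  then show "pinv A \<in> carrier_mat m n" "A * pinv A * A = A" using B_pen B by auto
qed

text \<open>\<open>X * X^T\<close> is the Gram matrix of \<open>X^T\<close>, so
  \<open>gram_inner_inverse\<close> applies to \<open>X^T\<close>; transposing yields the second
  claim. It means that \<beta> and its projection \<theta> generate the same regression
  mean.\<close>

lemma proj_X:
  assumes X: "X \<in> carrier_mat n p"
  shows "proj_X X \<in> carrier_mat p p" "X * proj_X X = X"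
proof -
  let ?T = "transpose_mat X"
  have XT: "X * ?T \<in> carrier_mat n n" "?T \<in> carrier_mat p n" using X by auto
  note B = pinv[OF XT(1)]
  note U = gram_inner_inverse[OF XT(2) B(1), unfolded transpose_transpose, OF B(2)]
  show P: "proj_X X \<in> carrier_mat p p" using X B(1) by (simp add: proj_X_def)
  have "X * proj_X X = transpose_mat (transpose_mat (proj_X X) * ?T)"
    using X P by (simp add: transpose_mult_dim)
  also have "\<dots> = X" using U by (simp add: proj_X_def)
  finally show "X * proj_X X = X" .
qed

text \<open>The projected vector has the form \<open>X^T y\<close>, and the scalar product of
  \<open>z\<close> with it is that of \<open>X z\<close> with \<open>y\<close>.\<close>

lemma proj_X_orthogonal_kernel:
  assumes X: "X \<in> carrier_mat n p" and b: "b \<in> carrier_vec p" and z: "z \<in> carrier_vec p" "X *\<^sub>v z = 0\<^sub>v n"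
  shows "scalar_prod z (proj_X X *\<^sub>v b) = 0"
proof -
  let ?T = "transpose_mat X"
  note B = pinv[of "X * ?T" n n]
  have XT: "X * ?T \<in> carrier_mat n n" using X by simp
  define y where "y = pinv (X * ?T) * X *\<^sub>v b"
  have y: "y \<in> carrier_vec n" unfolding y_def using B(1)[OF XT] X b by auto
  have "proj_X X *\<^sub>v b = ?T *\<^sub>v y"
    unfolding proj_X_def y_def using X b B(1)[OF XT]
    by (subst assoc_mult_mat[of _ p n _ n _ p], simp_all, subst assoc_mult_mat_vec[of _ p n _ p]) auto
  then have "scalar_prod z (proj_X X *\<^sub>v b) = scalar_prod (?T *\<^sub>v y) z"
    using X y z by (auto intro: comm_scalar_prod[of _ p])
  also have "\<dots> = scalar_prod y (X *\<^sub>v z)" by (rule transpose_vec_mult_scalar[OF X z(1) y])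
  finally show ?thesis using z y by simp
qed

subsection \<open>The smallest nonzero eigenvalue\<close>

lemma continuous_on_coordinate: "continuous_on S (\<lambda>x :: 'i \<Rightarrow> real. x i)"
  by (rule continuous_on_subset[OF continuous_on_product_coordinates]) simp

text \<open>Vectors of length \<open>p\<close> are modelled as functions on the naturals that vanish
  from \<open>p\<close> on; compactness is then Tychonoff for a product of intervals and
  singletons.\<close>

lemma compact_coordinate_box: "compact {x :: nat \<Rightarrow> real. (\<forall>i<p. \<bar>x i\<bar> \<le> 1) \<and> (\<forall>i\<ge>p. x i = 0)}"
proof -
  define S :: "nat \<Rightarrow> real set" where "S i = (if i < p then {-1..1} else {0})" for i
  have "compactin (product_topology (\<lambda>i :: nat. euclidean :: real topology) UNIV) (PiE UNIV S)"
    unfolding compactin_PiE by (auto simp: S_def)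
  moreover have "PiE UNIV S = {x. (\<forall>i<p. \<bar>x i\<bar> \<le> 1) \<and> (\<forall>i\<ge>p. x i = 0)}"
  proof -
    have "x i \<in> S i \<longleftrightarrow> (i < p \<longrightarrow> \<bar>x i\<bar> \<le> 1) \<and> (i \<ge> p \<longrightarrow> x i = 0)" for x i
      by (auto simp: S_def abs_le_iff)
    then show ?thesis unfolding PiE_UNIV_domain Pi_def by blast
  qed
  ultimately show ?thesis by (simp add: euclidean_product_topology)
qed

lemma scalar_prod_self_smult: "scalar_prod (c \<cdot>\<^sub>v v) (c \<cdot>\<^sub>v v) = c\<^sup>2 * scalar_prod v v" for v :: "real vec"
  by (simp add: power2_eq_square)

text \<open>The minimum of the Rayleigh quotient over the orthogonal complement of the kernel is attained,
  and it is a nonzero eigenvalue.\<close>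
lemma lambda_min_nz_rayleigh:
  fixes S :: "real mat"
  assumes S: "S \<in> carrier_mat p p" and sym: "transpose_mat S = S"
    and psd: "\<And>v. v \<in> carrier_vec p \<Longrightarrow> 0 \<le> scalar_prod v (S *\<^sub>v v)"
    and w: "w \<in> carrier_vec p" "w \<noteq> 0\<^sub>v p"
    and worth: "\<And>z. z \<in> carrier_vec p \<Longrightarrow> S *\<^sub>v z = 0\<^sub>v p \<Longrightarrow> scalar_prod z w = 0"
  shows "lambda_min_nz S > 0" "lambda_min_nz S * scalar_prod w w \<le> scalar_prod w (S *\<^sub>v w)"
proof -
  define W where "W = {x \<in> carrier_vec p. \<forall>z. z \<in> carrier_vec p \<longrightarrow> S *\<^sub>v z = 0\<^sub>v p \<longrightarrow> scalar_prod z x = 0}"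
  have Wc: "x \<in> carrier_vec p" if "x \<in> W" for x using that by (simp add: W_def)
  have W_smult: "c \<cdot>\<^sub>v x \<in> W" if "x \<in> W" for c x using that by (auto simp: W_def)
  have W_add: "x + y \<in> W" if "x \<in> W" "y \<in> W" for x y
    using that by (auto simp: W_def scalar_prod_add_distrib[of _ p])
  have S_sa: "scalar_prod (S *\<^sub>v x) y = scalar_prod x (S *\<^sub>v y)" if "x \<in> carrier_vec p" "y \<in> carrier_vec p" for x y
    using transpose_vec_mult_scalar[OF S that(2,1)] by (simp add: sym)
  have W_S: "S *\<^sub>v x \<in> W" if "x \<in> W" for x
  proof -
    have "scalar_prod z (S *\<^sub>v x) = 0" if "z \<in> carrier_vec p" "S *\<^sub>v z = 0\<^sub>v p" for z
      using S_sa[OF that(1) Wc[OF \<open>x \<in> W\<close>]] that Wc[OF \<open>x \<in> W\<close>] by simp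
    then show ?thesis using S Wc[OF that] by (auto simp: W_def)
  qed
  define f where "f x = scalar_prod (vec p x) (S *\<^sub>v vec p x)" for x :: "nat \<Rightarrow> real"
  define C where "C = {x :: nat \<Rightarrow> real. (\<forall>i<p. \<bar>x i\<bar> \<le> 1) \<and> (\<forall>i\<ge>p. x i = 0)} \<inter>
     ({x. (\<Sum>i<p. (x i)\<^sup>2) = 1} \<inter> (\<Inter>z\<in>{z \<in> carrier_vec p. S *\<^sub>v z = 0\<^sub>v p}. {x. (\<Sum>i<p. z $ i * x i) = 0}))"
  have "compact C"
    unfolding C_def
    by (intro compact_Int_closed compact_coordinate_box closed_Int closed_INT ballI closed_Collect_eq
        continuous_on_sum continuous_on_power continuous_on_mult continuous_on_const continuous_on_coordinate)
  have Cvec: "vec p x \<in> W" "scalar_prod (vec p x) (vec p x) = 1" if "x \<in> C" for x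
    using that by (auto simp: C_def W_def scalar_prod_def atLeast0LessThan power2_eq_square)
  have CI: "(\<lambda>i. if i < p then y $ i else 0) \<in> C" if y: "y \<in> W" "scalar_prod y y = 1" for y
  proof -
    have yc: "dim_vec y = p" using Wc[OF y(1)] by simp
    have s: "(\<Sum>i<p. (y $ i)\<^sup>2) = 1" using y(2) unfolding scalar_prod_self_real yc .
    have "\<bar>y $ i\<bar> \<le> 1" if "i < p" for i
    proof -
      have "(y $ i)\<^sup>2 \<le> (\<Sum>i<p. (y $ i)\<^sup>2)" using that by (intro member_le_sum) auto
      then show ?thesis unfolding s by (simp add: abs_square_le_1)
    qed
    moreover have "(\<Sum>i<p. z $ i * y $ i) = 0" if "z \<in> carrier_vec p" "S *\<^sub>v z = 0\<^sub>v p" for z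
      using y(1) that yc by (auto simp: W_def scalar_prod_def atLeast0LessThan)
    ultimately show ?thesis using s by (simp add: C_def)
  qed
  have vec_eq: "vec p (\<lambda>i. if i < p then y $ i else 0) = y" if "y \<in> carrier_vec p" for y
    using that by (intro eq_vecI) auto
  have normal: "(1 / sqrt (scalar_prod y y)) \<cdot>\<^sub>v y \<in> W" "scalar_prod y y > 0"
    "scalar_prod ((1 / sqrt (scalar_prod y y)) \<cdot>\<^sub>v y) ((1 / sqrt (scalar_prod y y)) \<cdot>\<^sub>v y) = 1"
    if "y \<in> W" "y \<noteq> 0\<^sub>v p" for y
  proof -
    show pos: "scalar_prod y y > 0"
      using scalar_prod_self_nonneg[of y] scalar_prod_self_eq_0[OF Wc[OF that(1)]] that(2) by linarith
    show "(1 / sqrt (scalar_prod y y)) \<cdot>\<^sub>v y \<in> W" by (rule W_smult[OF that(1)])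
    show "scalar_prod ((1 / sqrt (scalar_prod y y)) \<cdot>\<^sub>v y) ((1 / sqrt (scalar_prod y y)) \<cdot>\<^sub>v y) = 1"
      unfolding scalar_prod_self_smult using pos by (simp add: power_divide)
  qed
  have wW: "w \<in> W" using w worth by (auto simp: W_def)
  have "C \<noteq> {}" using CI[OF normal(1,3)[OF wW w(2)]] by blast
  moreover have "continuous_on C f"
    unfolding f_def using S
    by (simp add: scalar_prod_def)
      (intro continuous_on_sum continuous_on_mult continuous_on_const continuous_on_coordinate)
  ultimately obtain x where x: "x \<in> C" "\<And>y. y \<in> C \<Longrightarrow> f x \<le> f y"
    using continuous_attains_inf[OF \<open>compact C\<close>] by blast
  define x0 where "x0 = vec p x"
  define \<mu> where "\<mu> = f x"
  have x0: "x0 \<in> W" "scalar_prod x0 x0 = 1" using Cvec[OF x(1)] by (auto simp: x0_def)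
  have x0c: "x0 \<in> carrier_vec p" by (rule Wc[OF x0(1)])
  have \<mu>: "\<mu> = scalar_prod x0 (S *\<^sub>v x0)" by (simp add: \<mu>_def f_def x0_def)
  have rayleigh: "\<mu> * scalar_prod y y \<le> scalar_prod y (S *\<^sub>v y)" if y: "y \<in> W" for y
  proof (cases "y = 0\<^sub>v p")
    case True
    then show ?thesis using psd[of "0\<^sub>v p"] by simp
  next
    case False
    let ?c = "1 / sqrt (scalar_prod y y)"
    have "\<mu> \<le> scalar_prod (?c \<cdot>\<^sub>v y) (S *\<^sub>v (?c \<cdot>\<^sub>v y))"
      using x(2)[OF CI[OF normal(1,3)[OF y False]]] vec_eq[of "?c \<cdot>\<^sub>v y"] Wc[OF y]
      by (simp add: \<mu>_def f_def)
    also have "\<dots> = ?c * (?c * scalar_prod y (S *\<^sub>v y))"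
      using S Wc[OF y] by (simp add: mult_mat_vec[OF S Wc[OF y]])
    also have "\<dots> = scalar_prod y (S *\<^sub>v y) / scalar_prod y y"
      using normal(2)[OF y False] by simp
    finally show ?thesis using normal(2)[OF y False] by (simp add: field_simps)
  qed
  have stationary: "scalar_prod (S *\<^sub>v x0) y = \<mu> * scalar_prod x0 y" if y: "y \<in> W" for y
  proof -
    define d where "d = scalar_prod (S *\<^sub>v x0) y - \<mu> * scalar_prod x0 y"
    define e where "e = scalar_prod y (S *\<^sub>v y) - \<mu> * scalar_prod y y"
    note yc = Wc[OF y]
    have sy: "scalar_prod x0 (S *\<^sub>v y) = scalar_prod (S *\<^sub>v x0) y" using S_sa[OF x0c yc] by simp
    have ys: "scalar_prod y (S *\<^sub>v x0) = scalar_prod (S *\<^sub>v x0) y" using S yc x0c by (auto intro: comm_scalar_prod[of _ p])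
    have xy: "scalar_prod y x0 = scalar_prod x0 y" using yc x0c by (rule comm_scalar_prod)
    \<comment> \<open>First variation: \<open>x0 + t \<cdot>\<^sub>v y\<close> stays in
      \<open>W\<close>, so the Rayleigh inequality holds there for every \<open>t\<close>. A
      quadratic in \<open>t\<close> without constant term is nonnegative everywhere only if its
      linear coefficient vanishes.\<close>
    have quad: "0 \<le> 2 * t * d + t\<^sup>2 * e" for t
    proof -
      have "x0 + t \<cdot>\<^sub>v y \<in> W" using x0(1) W_smult[OF y] W_add by blast
      note r = rayleigh[OF this]
      have 1: "scalar_prod (x0 + t \<cdot>\<^sub>v y) (x0 + t \<cdot>\<^sub>v y) = 1 + 2 * t * scalar_prod x0 y + t\<^sup>2 * scalar_prod y y"
        using x0c yc by (simp add: scalar_prod_add_distrib[of _ p] add_scalar_prod_distrib[of _ p] x0(2) xy power2_eq_square algebra_simps)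
      have 2: "scalar_prod (x0 + t \<cdot>\<^sub>v y) (S *\<^sub>v (x0 + t \<cdot>\<^sub>v y)) = \<mu> + 2 * t * scalar_prod (S *\<^sub>v x0) y + t\<^sup>2 * scalar_prod y (S *\<^sub>v y)"
        using S x0c yc by (simp add: mult_add_distrib_mat_vec[OF S] mult_mat_vec[OF S] scalar_prod_add_distrib[of _ p]
            add_scalar_prod_distrib[of _ p] sy ys \<mu>[symmetric] power2_eq_square algebra_simps)
      show ?thesis using r unfolding 1 2 d_def e_def by (simp add: algebra_simps)
    qed
    have "d = 0"
    proof (rule ccontr)
      assume d: "d \<noteq> 0"
      \<comment> \<open>For \<open>t = - d / a\<close> the quadratic equals
        \<open>(d\<^sup>2 / a\<^sup>2) * (e - 2 * a)\<close>, which is negative once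
        \<open>a\<close> is positive and exceeds \<open>e\<close>.\<close>
      define a where "a = \<bar>e\<bar> + 1"
      have a: "a > 0" "e < a" by (auto simp: a_def)
      have "0 \<le> 2 * (- d / a) * d + (- d / a)\<^sup>2 * e" by (rule quad)
      also have "\<dots> = (d\<^sup>2 / a\<^sup>2) * (e - 2 * a)" using a by (simp add: field_simps power2_eq_square)
      also have "\<dots> < 0" using a d by (intro mult_pos_neg) auto
      finally show False by simp
    qed
    then show ?thesis by (simp add: d_def)
  qed
  have Sx0: "S *\<^sub>v x0 = \<mu> \<cdot>\<^sub>v x0"
  proof -
    \<comment> \<open>The residual lies in \<open>W\<close> itself, because a symmetric
      \<open>S\<close> maps the complement of its kernel into itself. It can thus be used as its own
      test vector.\<close>
    define y where "y = S *\<^sub>v x0 + (- \<mu>) \<cdot>\<^sub>v x0"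
    have y: "y \<in> W" unfolding y_def using W_add W_S W_smult x0(1) by blast
    have "scalar_prod y y = scalar_prod (S *\<^sub>v x0) y - \<mu> * scalar_prod x0 y"
      using S x0c Wc[OF y] by (subst (1) y_def) (simp add: add_scalar_prod_distrib[of _ p])
    then have "y = 0\<^sub>v p" using stationary[OF y] scalar_prod_self_eq_0[OF Wc[OF y]] by simp
    then have "y $ i = 0" if "i < p" for i using that by simp
    then show ?thesis using S x0c by (intro eq_vecI) (auto simp: y_def)
  qed
  have x0nz: "x0 \<noteq> 0\<^sub>v p" using x0(2) by auto
  \<comment> \<open>Otherwise \<open>x0\<close> would lie in the kernel and in its orthogonal
    complement, although it has norm 1.\<close>
  have "\<mu> \<noteq> 0"
  proof
    assume "\<mu> = 0"
    then have "S *\<^sub>v x0 = 0\<^sub>v p" using Sx0 x0c by (intro eq_vecI) auto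
    then show False using x0 x0c by (auto simp: W_def)
  qed
  moreover have "eigenvalue S \<mu>" unfolding eigenvalue_def eigenvector_def using S Sx0 x0c x0nz by auto
  ultimately have mem: "\<mu> \<in> {k. eigenvalue S k \<and> k \<noteq> 0}" by simp
  \<comment> \<open>\<open>lambda_min_nz\<close> is a \<open>Min\<close>; finiteness of the spectrum
    and the member \<open>\<mu>\<close> make it an actual eigenvalue.\<close>
  have fin: "finite {k. eigenvalue S k \<and> k \<noteq> 0}"
    using card_finite_spectrum(1)[OF S] by (rule rev_finite_subset) (auto simp: spectrum_def)
  have pos: "k > 0" if ev: "eigenvalue S k" and k0: "k \<noteq> 0" for k
  proof -
    obtain v where v: "v \<in> carrier_vec p" "v \<noteq> 0\<^sub>v p" "S *\<^sub>v v = k \<cdot>\<^sub>v v"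
      using ev S unfolding eigenvalue_def eigenvector_def by auto
    have "0 \<le> k * scalar_prod v v" using psd[OF v(1)] v by simp
    moreover have "scalar_prod v v > 0"
      using scalar_prod_self_nonneg[of v] scalar_prod_self_eq_0[OF v(1)] v(2) by linarith
    ultimately show ?thesis using k0 by (simp add: zero_le_mult_iff)
  qed
  have "lambda_min_nz S \<in> {k. eigenvalue S k \<and> k \<noteq> 0}"
    unfolding lambda_min_nz_def by (rule Min_in) (use fin mem in auto)
  then show "lambda_min_nz S > 0" using pos by blast
  have "lambda_min_nz S \<le> \<mu>" unfolding lambda_min_nz_def by (rule Min_le[OF fin mem])
  then have "lambda_min_nz S * scalar_prod w w \<le> \<mu> * scalar_prod w w"
    by (intro mult_right_mono scalar_prod_self_nonneg)
  also have "\<dots> \<le> scalar_prod w (S *\<^sub>v w)" by (rule rayleigh[OF wW])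
  finally show "lambda_min_nz S * scalar_prod w w \<le> scalar_prod w (S *\<^sub>v w)" .
qed

subsection \<open>The ridge estimator\<close>

lemma transpose_smult_mat: "transpose_mat (c \<cdot>\<^sub>m A) = c \<cdot>\<^sub>m transpose_mat A"
  by (intro eq_matI) auto

lemma smult_mat_mult_vec:
  fixes A :: "'a :: comm_semiring_0 mat"
  assumes "v \<in> carrier_vec (dim_col A)"
  shows "(c \<cdot>\<^sub>m A) *\<^sub>v v = c \<cdot>\<^sub>v (A *\<^sub>v v)"
  using assms by (intro eq_vecI) auto

lemma Sigma_hat:
  assumes X: "X \<in> carrier_mat n p"
  shows "Sigma_hat X \<in> carrier_mat p p" "transpose_mat (Sigma_hat X) = Sigma_hat X"
    and "v \<in> carrier_vec p \<Longrightarrow> Sigma_hat X *\<^sub>v v = (1 / real n) \<cdot>\<^sub>v (transpose_mat X *\<^sub>v (X *\<^sub>v v))"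
    and "v \<in> carrier_vec p \<Longrightarrow> scalar_prod v (Sigma_hat X *\<^sub>v v) = scalar_prod (X *\<^sub>v v) (X *\<^sub>v v) / real n"
proof -
  let ?T = "transpose_mat X"
  have T: "?T \<in> carrier_mat p n" using X by simp
  show "Sigma_hat X \<in> carrier_mat p p" using X by (simp add: Sigma_hat_def)
  show "transpose_mat (Sigma_hat X) = Sigma_hat X"
    unfolding Sigma_hat_def transpose_smult_mat by (simp add: transpose_mult_dim)
  show 1: "Sigma_hat X *\<^sub>v v = (1 / real n) \<cdot>\<^sub>v (?T *\<^sub>v (X *\<^sub>v v))" if v: "v \<in> carrier_vec p" for v
  proof -
    have "Sigma_hat X *\<^sub>v v = (1 / real n) \<cdot>\<^sub>v (?T * X *\<^sub>v v)"
      unfolding Sigma_hat_def using X v by (subst smult_mat_mult_vec) auto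
    then show ?thesis using assoc_mult_mat_vec[OF T X v] by simp
  qed
  assume v: "v \<in> carrier_vec p"
  have "scalar_prod v (Sigma_hat X *\<^sub>v v) = (1 / real n) * scalar_prod v (?T *\<^sub>v (X *\<^sub>v v))"
    unfolding 1[OF v] using X v by simp
  also have "scalar_prod v (?T *\<^sub>v (X *\<^sub>v v)) = scalar_prod (?T *\<^sub>v (X *\<^sub>v v)) v"
    using X v by (intro comm_scalar_prod[of _ p]) auto
  also have "\<dots> = scalar_prod (X *\<^sub>v v) (X *\<^sub>v v)"
    using X v by (intro transpose_vec_mult_scalar[OF X v]) auto
  finally show "scalar_prod v (Sigma_hat X *\<^sub>v v) = scalar_prod (X *\<^sub>v v) (X *\<^sub>v v) / real n" by simp
qed

definition ridge_mat :: "real mat \<Rightarrow> real \<Rightarrow> real mat" where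
  "ridge_mat X lam = minv (Sigma_hat X + lam \<cdot>\<^sub>m 1\<^sub>m (dim_col X))"

context
  fixes X :: "real mat" and n p :: nat and lam :: real
  assumes X: "X \<in> carrier_mat n p" and n: "n \<ge> 1" and lam: "lam > 0"
begin

private abbreviation "S \<equiv> Sigma_hat X"
private abbreviation "K \<equiv> S + lam \<cdot>\<^sub>m 1\<^sub>m p"
private abbreviation "R \<equiv> ridge_mat X lam"

private lemma K_carrier: "K \<in> carrier_mat p p" by simp

private lemma K_mult:
  assumes "v \<in> carrier_vec p" shows "K *\<^sub>v v = S *\<^sub>v v + lam \<cdot>\<^sub>v v"
proof -
  have "lam \<cdot>\<^sub>m 1\<^sub>m p *\<^sub>v v = lam \<cdot>\<^sub>v v"
  proof -
    have "lam \<cdot>\<^sub>m 1\<^sub>m p *\<^sub>v v = lam \<cdot>\<^sub>v (1\<^sub>m p *\<^sub>v v)"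
      using assms by (intro eq_vecI) auto
    then show ?thesis using assms by simp
  qed
  then show ?thesis using assms Sigma_hat(1)[OF X] by (simp add: add_mult_distrib_mat_vec[of _ p p])
qed

text \<open>\<open>K\<close> is positive definite, so its kernel is trivial and
  \<open>mat_inverse\<close> does return a matrix. Symmetry follows because the transpose of the
  inverse is again a left inverse of the symmetric \<open>K\<close>.\<close>

lemma ridge_mat_inverse:
  "R \<in> carrier_mat p p" "K * R = 1\<^sub>m p" "R * K = 1\<^sub>m p" "transpose_mat R = R"
proof -
  note S = Sigma_hat[OF X]
  have "det K \<noteq> 0"
  proof
    assume "det K = 0"
    then obtain v where v: "v \<in> carrier_vec p" "v \<noteq> 0\<^sub>v p" "K *\<^sub>v v = 0\<^sub>v p"
      using det_0_iff_vec_prod_zero[OF K_carrier] by blast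
    have "scalar_prod v (K *\<^sub>v v) = scalar_prod v (S *\<^sub>v v) + lam * scalar_prod v v"
      unfolding K_mult[OF v(1)] using v S(1) by (simp add: scalar_prod_add_distrib[of _ p])
    also have "\<dots> > 0"
    proof -
      have "scalar_prod v v > 0" using v scalar_prod_self_nonneg[of v] scalar_prod_self_eq_0[OF v(1)] by linarith
      moreover have "0 \<le> scalar_prod v (S *\<^sub>v v)" unfolding S(4)[OF v(1)] by (simp add: scalar_prod_self_nonneg)
      ultimately show ?thesis using lam by (simp add: add_nonneg_pos)
    qed
    finally show False using v by simp
  qed
  then have "K \<in> Units (ring_mat TYPE(real) p ())" by (rule det_non_zero_imp_unit[OF K_carrier])
  then obtain B where B: "mat_inverse K = Some B"
    using mat_inverse(1)[OF K_carrier, of "()"] by (cases "mat_inverse K") auto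
  have R: "R = B" using B X by (simp add: ridge_mat_def minv_def)
  show R1: "R \<in> carrier_mat p p" "K * R = 1\<^sub>m p" "R * K = 1\<^sub>m p"
    using mat_inverse(2)[OF K_carrier B] unfolding R by auto
  have KT: "transpose_mat K = K" using S by (simp add: transpose_add transpose_smult_mat)
  have dims: "dim_row R = p" "dim_col R = p" "dim_row K = p" "dim_col K = p" using R1 by auto
  have "transpose_mat R * K = transpose_mat (K * R)"
    using dims by (subst transpose_mult_dim) (simp_all add: KT del: dim_row_mat dim_col_mat)
  then have TK: "transpose_mat R * K = 1\<^sub>m p" unfolding R1 by simp
  have "transpose_mat R = transpose_mat R * (K * R)" unfolding R1 using R1 by simp
  also have "\<dots> = transpose_mat R * K * R" using R1 by (subst assoc_mult_mat[of _ p p _ p _ p]) auto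
  also have "\<dots> = R" unfolding TK using R1 by simp
  finally show "transpose_mat R = R" .
qed

text \<open>The signal enters only through \<open>X *\<^sub>v b = X *\<^sub>v \<theta>\<close>,
  hence through \<open>S *\<^sub>v \<theta>\<close>, which is \<open>K *\<^sub>v \<theta>\<close>
  minus \<open>lam\<close> times \<open>\<theta>\<close>. Applying \<open>R\<close> leaves
  \<open>\<theta>\<close> and the shrinkage bias.\<close>

lemma ridge_decomposition:
  assumes b: "b \<in> carrier_vec p" and e: "e \<in> carrier_vec n" and j: "j < p"
  defines "\<theta> \<equiv> proj_X X *\<^sub>v b"
  shows "ridge X lam (X *\<^sub>v b + e) $ j = \<theta> $ j - lam * (R *\<^sub>v \<theta>) $ j
    + (\<Sum>i<n. ((1 / real n) \<cdot>\<^sub>m (R * transpose_mat X)) $$ (j, i) * e $ i)"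
proof -
  let ?T = "transpose_mat X"
  note S = Sigma_hat[OF X] and RR = ridge_mat_inverse and P = proj_X[OF X]
  have T: "?T \<in> carrier_mat p n" using X by simp
  have \<theta>: "\<theta> \<in> carrier_vec p" using P b by (auto simp: \<theta>_def)
  have "X *\<^sub>v \<theta> = X *\<^sub>v b" unfolding \<theta>_def using assoc_mult_mat_vec[OF X P(1) b] P(2) by simp
  then have S\<theta>: "(1 / real n) \<cdot>\<^sub>v (?T *\<^sub>v (X *\<^sub>v b)) = S *\<^sub>v \<theta>" using S(3)[OF \<theta>] by simp
  have K\<theta>: "S *\<^sub>v \<theta> = K *\<^sub>v \<theta> - lam \<cdot>\<^sub>v \<theta>"
    unfolding K_mult[OF \<theta>] using S(1) \<theta> by (intro eq_vecI) auto
  have RK\<theta>: "R *\<^sub>v (K *\<^sub>v \<theta>) = \<theta>"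
    using assoc_mult_mat_vec[OF RR(1) K_carrier \<theta>] RR(3) \<theta> by simp
  have c: "S *\<^sub>v \<theta> \<in> carrier_vec p" "?T *\<^sub>v e \<in> carrier_vec p" "K *\<^sub>v \<theta> \<in> carrier_vec p"
    using S(1) \<theta> T e mult_mat_vec_carrier[OF K_carrier \<theta>] by auto
  have "ridge X lam (X *\<^sub>v b + e) = R *\<^sub>v ((1 / real n) \<cdot>\<^sub>v (?T *\<^sub>v (X *\<^sub>v b + e)))"
    using X by (simp add: ridge_def ridge_mat_def)
  also have "(1 / real n) \<cdot>\<^sub>v (?T *\<^sub>v (X *\<^sub>v b + e)) = S *\<^sub>v \<theta> + (1 / real n) \<cdot>\<^sub>v (?T *\<^sub>v e)"
    unfolding S\<theta>[symmetric] using T X b e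
    by (subst mult_add_distrib_mat_vec[OF T]) (auto intro!: smult_add_distrib_vec[of _ p])
  also have "R *\<^sub>v (S *\<^sub>v \<theta> + (1 / real n) \<cdot>\<^sub>v (?T *\<^sub>v e)) = R *\<^sub>v (S *\<^sub>v \<theta>) + (1 / real n) \<cdot>\<^sub>v (R *\<^sub>v (?T *\<^sub>v e))"
    using c by (subst mult_add_distrib_mat_vec[OF RR(1)]) (auto simp: mult_mat_vec[OF RR(1)])
  also have "R *\<^sub>v (S *\<^sub>v \<theta>) = \<theta> - lam \<cdot>\<^sub>v (R *\<^sub>v \<theta>)"
    unfolding K\<theta> using c \<theta> by (subst mult_minus_distrib_mat_vec[OF RR(1)]) (auto simp: mult_mat_vec[OF RR(1)] RK\<theta>)
  finally have "ridge X lam (X *\<^sub>v b + e) = \<theta> - lam \<cdot>\<^sub>v (R *\<^sub>v \<theta>) + (1 / real n) \<cdot>\<^sub>v (R * ?T *\<^sub>v e)"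
    using assoc_mult_mat_vec[OF RR(1) T e] by simp
  moreover have "((1 / real n) \<cdot>\<^sub>v (R * ?T *\<^sub>v e)) $ j = (\<Sum>i<n. ((1 / real n) \<cdot>\<^sub>m (R * ?T)) $$ (j, i) * e $ i)"
  proof -
    have "((1 / real n) \<cdot>\<^sub>v (A *\<^sub>v e)) $ j = (\<Sum>i<n. ((1 / real n) \<cdot>\<^sub>m A) $$ (j, i) * e $ i)"
      if "A \<in> carrier_mat p n" for A :: "real mat"
    proof -
      have "((1 / real n) \<cdot>\<^sub>v (A *\<^sub>v e)) $ j = (1 / real n) * (\<Sum>i<n. A $$ (j, i) * e $ i)"
        using that e j by (auto simp: scalar_prod_def atLeast0LessThan)
      then show ?thesis unfolding sum_distrib_left using that j by (auto intro!: sum.cong)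
    qed
    then show ?thesis using mult_carrier_mat[OF RR(1) T] by blast
  qed
  ultimately show ?thesis using RR(1) \<theta> j T by simp
qed

text \<open>Pairing \<open>K *\<^sub>v w = \<theta>\<close> with \<open>w\<close> gives, for the
  smallest nonzero eigenvalue \<kappa>, that \<kappa> times the squared norm of \<open>w\<close> is
  at most the scalar product of \<open>w\<close> and \<open>\<theta>\<close>; Cauchy-Schwarz and
  cancelling one norm of \<open>w\<close> finish the bound.\<close>

lemma ridge_bias_bound:
  assumes b: "b \<in> carrier_vec p" and j: "j < p"
  defines "\<theta> \<equiv> proj_X X *\<^sub>v b"
  shows "0 \<le> norm2 \<theta> / lambda_min_nz S" "\<bar>(R *\<^sub>v \<theta>) $ j\<bar> \<le> norm2 \<theta> / lambda_min_nz S"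
proof -
  note S = Sigma_hat[OF X] and RR = ridge_mat_inverse and P = proj_X[OF X]
  have \<theta>: "\<theta> \<in> carrier_vec p" using P b by (auto simp: \<theta>_def)
  define w where "w = R *\<^sub>v \<theta>"
  have w: "w \<in> carrier_vec p" using RR(1) \<theta> by (auto simp: w_def)
  have "0 \<le> norm2 \<theta> / lambda_min_nz S \<and> \<bar>w $ j\<bar> \<le> norm2 \<theta> / lambda_min_nz S"
  proof (cases "\<theta> = 0\<^sub>v p")
    \<comment> \<open>Here the spectrum of \<open>S\<close> may have no nonzero member; the quotient
      is 0 because its numerator is.\<close>
    case True
    then have "w = 0\<^sub>v p" using RR(1) by (auto simp: w_def)
    moreover have "norm2 \<theta> = 0" using True by (simp add: norm2_def)
    ultimately show ?thesis using j by simp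
  next
    case False
    have Kw: "K *\<^sub>v w = \<theta>"
      unfolding w_def using assoc_mult_mat_vec[OF K_carrier RR(1) \<theta>] RR(2) \<theta> by simp
    have w0: "w \<noteq> 0\<^sub>v p"
    proof
      assume "w = 0\<^sub>v p"
      moreover have "K *\<^sub>v 0\<^sub>v p = 0\<^sub>v p" using S(1) by (intro eq_vecI) auto
      ultimately have "K *\<^sub>v w = 0\<^sub>v p" by simp
      then show False using Kw False by simp
    qed
    \<comment> \<open>The kernels of \<open>S\<close> and \<open>X\<close> agree,
      \<open>\<theta>\<close> is orthogonal to them, and \<open>R\<close> acts on them as division
      by \<open>lam\<close>. Symmetry of \<open>R\<close> moves it from \<open>\<theta>\<close> to
      \<open>z\<close>.\<close>
    have orth: "scalar_prod z w = 0" if z: "z \<in> carrier_vec p" "S *\<^sub>v z = 0\<^sub>v p" for z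
    proof -
      have "scalar_prod (X *\<^sub>v z) (X *\<^sub>v z) = 0" using S(4)[OF z(1)] z n by simp
      then have "X *\<^sub>v z = 0\<^sub>v n" using scalar_prod_self_eq_0[of "X *\<^sub>v z" n] X z by auto
      then have z\<theta>: "scalar_prod z \<theta> = 0" unfolding \<theta>_def using proj_X_orthogonal_kernel[OF X b z(1)] by simp
      have "K *\<^sub>v z = lam \<cdot>\<^sub>v z" unfolding K_mult[OF z(1)] using z by simp
      then have "R *\<^sub>v (lam \<cdot>\<^sub>v z) = z" using assoc_mult_mat_vec[OF RR(1) K_carrier z(1)] RR(3) z by simp
      then have "lam \<cdot>\<^sub>v (R *\<^sub>v z) = z" using mult_mat_vec[OF RR(1) z(1)] by simp
      then have "scalar_prod z \<theta> = scalar_prod (lam \<cdot>\<^sub>v (R *\<^sub>v z)) \<theta>" by simp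
      also have "\<dots> = lam * scalar_prod (R *\<^sub>v z) \<theta>" using RR(1) z \<theta> by simp
      also have "scalar_prod (R *\<^sub>v z) \<theta> = scalar_prod z w"
        unfolding w_def using transpose_vec_mult_scalar[OF RR(1) \<theta> z(1)] RR(4) by simp
      finally show ?thesis using z\<theta> lam by simp
    qed
    define \<kappa> where "\<kappa> = lambda_min_nz S"
    have psd: "0 \<le> scalar_prod v (S *\<^sub>v v)" if "v \<in> carrier_vec p" for v
      unfolding S(4)[OF that] by (simp add: scalar_prod_self_nonneg)
    note ray = lambda_min_nz_rayleigh[OF S(1,2) psd w w0 orth, folded \<kappa>_def]
    define q where "q = (\<Sum>i<p. (w $ i)\<^sup>2)"
    have q: "q = scalar_prod w w" using scalar_prod_self_real[of w] w by (simp add: q_def)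
    have q0: "q > 0" using q scalar_prod_self_nonneg[of w] scalar_prod_self_eq_0[OF w] w0 by linarith
    have "scalar_prod w \<theta> = scalar_prod w (S *\<^sub>v w) + lam * q"
      unfolding q Kw[symmetric] K_mult[OF w] using w S(1) by (simp add: scalar_prod_add_distrib[of _ p])
    then have "\<kappa> * q \<le> scalar_prod w \<theta>" using ray(2) mult_pos_pos[OF lam q0] unfolding q by linarith
    moreover have "scalar_prod w \<theta> = (\<Sum>i<p. w $ i * \<theta> $ i)"
      using \<theta> by (simp add: scalar_prod_def atLeast0LessThan)
    ultimately have le: "\<kappa> * q \<le> (\<Sum>i<p. w $ i * \<theta> $ i)" by (simp only:)
    have "0 \<le> \<kappa> * q" using mult_pos_pos[OF ray(1) q0] by (rule less_imp_le)
    then have "(\<kappa> * q)\<^sup>2 \<le> (\<Sum>i<p. w $ i * \<theta> $ i)\<^sup>2" by (rule power_mono[OF le])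
    also have "\<dots> \<le> q * (norm2 \<theta>)\<^sup>2"
      using Cauchy_Schwarz_ineq_sum[of "\<lambda>i. w $ i" "\<lambda>i. \<theta> $ i" "{..<p}"] \<theta>
      by (simp add: q_def norm2_def sum_nonneg)
    finally have "q * (\<kappa>\<^sup>2 * q) \<le> q * (norm2 \<theta>)\<^sup>2" by (simp add: power2_eq_square ac_simps)
    then have "\<kappa>\<^sup>2 * q \<le> (norm2 \<theta>)\<^sup>2" using q0 by simp
    moreover have "(w $ j)\<^sup>2 \<le> q" unfolding q_def using j by (intro member_le_sum) auto
    ultimately have "(\<kappa> * \<bar>w $ j\<bar>)\<^sup>2 \<le> (norm2 \<theta>)\<^sup>2"
      by (simp add: power_mult_distrib) (meson mult_left_mono order_trans zero_le_power2)
    then have "\<kappa> * \<bar>w $ j\<bar> \<le> norm2 \<theta>"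
      by (rule power2_le_imp_le) (simp add: norm2_def sum_nonneg)
    then have "\<bar>w $ j\<bar> * \<kappa> \<le> norm2 \<theta>" by (simp only: mult.commute)
    then have "\<bar>w $ j\<bar> \<le> norm2 \<theta> / \<kappa>" by (simp only: pos_le_divide_eq[OF ray(1)])
    moreover have "0 \<le> norm2 \<theta>" by (simp add: norm2_def sum_nonneg)
    then have "0 \<le> norm2 \<theta> / \<kappa>" using ray(1) by (rule divide_nonneg_pos)
    ultimately show ?thesis unfolding \<kappa>_def[symmetric] by blast
  qed
  then show "0 \<le> norm2 \<theta> / lambda_min_nz S" "\<bar>(R *\<^sub>v \<theta>) $ j\<bar> \<le> norm2 \<theta> / lambda_min_nz S"
    by (auto simp: w_def)
qed

text \<open>\<open>T\<close> is the matrix by which the noise enters the estimator. As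
  \<open>X^T * X\<close> is \<open>n\<close> times \<open>S\<close>, the product
  \<open>T * T^T\<close> equals \<open>R * S * R / n\<close>.\<close>

lemma ridge_noise_covariance:
  assumes j: "j < p" and k: "k < p"
  defines "T \<equiv> (1 / real n) \<cdot>\<^sub>m (R * transpose_mat X)"
  shows "(\<Sum>i<n. T $$ (j, i) * T $$ (k, i)) = Omega X lam $$ (j, k) / real n"
proof -
  note S = Sigma_hat[OF X] and RR = ridge_mat_inverse
  have dims: "dim_row R = p" "dim_col R = p" "dim_row X = n" "dim_col X = p" using X RR by auto
  have O: "Omega X lam = R * S * R" using X by (simp add: Omega_def ridge_mat_def Let_def)
  have T: "T \<in> carrier_mat p n" unfolding T_def using RR X by auto
  have "R * S * R = (1 / real n) \<cdot>\<^sub>m (R * transpose_mat X * transpose_mat (R * transpose_mat X))"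
  proof -
    have "R * S = (1 / real n) \<cdot>\<^sub>m (R * (transpose_mat X * X))"
      unfolding Sigma_hat_def using dims X RR by (simp add: mult_smult_distrib[of _ p p _ p])
    then have "R * S * R = (1 / real n) \<cdot>\<^sub>m (R * (transpose_mat X * X) * R)"
      using X RR by (simp add: mult_smult_assoc_mat[of _ p p _ p])
    then show ?thesis using dims RR(4) by (simp add: mult_mat_assoc_dim transpose_mult_dim)
  qed
  then have "Omega X lam $$ (j, k) = (1 / real n) * (\<Sum>i<n. (R * transpose_mat X) $$ (j, i) * (R * transpose_mat X) $$ (k, i))"
    unfolding O using dims j k by (simp add: scalar_prod_def[of "row (R * transpose_mat X) j"] atLeast0LessThan)
  moreover have "(\<Sum>i<n. T $$ (j, i) * T $$ (k, i)) = (1 / real n)\<^sup>2 * (\<Sum>i<n. (R * transpose_mat X) $$ (j, i) * (R * transpose_mat X) $$ (k, i))"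
    unfolding sum_distrib_left T_def using dims j k by (intro sum.cong refl) (simp add: power2_eq_square)
  ultimately show ?thesis by (simp add: power2_eq_square)
qed

end

subsection \<open>Comparison of tails\<close>

lemma distributed_normal_char:
  assumes M: "prob_space M" and X: "distributed M lborel X (\<lambda>x. ennreal (normal_density 0 \<sigma> x))" and \<sigma>: "\<sigma> > 0"
  shows "(CLINT \<omega>|M. iexp (t * X \<omega>)) = complex_of_real (exp (- (t * \<sigma>)\<^sup>2 / 2))"
proof -
  have Z: "distributed M lborel (\<lambda>\<omega>. X \<omega> / \<sigma>) (\<lambda>x. ennreal (std_normal_density x))"
    using prob_space.normal_standard_normal_convert[OF M \<sigma>, of X 0] X by simp
  have [measurable]: "(\<lambda>\<omega>. X \<omega> / \<sigma>) \<in> borel_measurable M" using Z by (auto simp: distributed_def)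
  have "(CLINT \<omega>|M. iexp (t * X \<omega>)) = (CLINT \<omega>|M. iexp ((t * \<sigma>) * (X \<omega> / \<sigma>)))"
    using \<sigma> by simp
  also have "\<dots> = (CLINT x|distr M lborel (\<lambda>\<omega>. X \<omega> / \<sigma>). iexp ((t * \<sigma>) * x))"
    by (subst integral_distr) auto
  also have "\<dots> = char std_normal_distribution (t * \<sigma>)"
    using Z by (simp add: distributed_def char_def)
  finally show ?thesis by (simp add: char_std_normal_distribution)
qed

lemma char_normal_law:
  assumes "0 \<le> s"
  shows "(CLINT x|normal_law 0 s. iexp x) = complex_of_real (exp (- s / 2))"
proof (cases "s = 0")
  case True
  then show ?thesis by (simp add: normal_law_def integral_return)
next
  case False
  let ?f = "\<lambda>x. ennreal (normal_density 0 (sqrt s) x)"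
  have "distributed (density lborel ?f) lborel (\<lambda>x. x) ?f"
    by (auto simp: distributed_def intro!: measure_eqI simp: emeasure_distr)
  from distributed_normal_char[OF prob_space_normal_density this, of 1] show ?thesis
    using assms False by (simp add: normal_law_def)
qed

lemma gaussian_family_iid:
  assumes M: "prob_space M" and \<sigma>: "\<sigma> > 0" and I: "finite I"
    and indep: "prob_space.indep_vars M (\<lambda>_. borel) X I"
    and X: "\<And>i. i \<in> I \<Longrightarrow> distributed M lborel (X i) (\<lambda>x. ennreal (normal_density 0 \<sigma> x))"
  shows "gaussian_family M I X (\<lambda>i j. if i = j then \<sigma>\<^sup>2 else 0)"
  unfolding gaussian_family_def
proof (intro conjI ballI allI)
  interpret prob_space M by fact
  show Xm: "X i \<in> borel_measurable M" if "i \<in> I" for i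
    using X[OF that] by (simp add: distributed_def)
  fix v
  have vm: "(\<lambda>\<omega>. v i * X i \<omega>) \<in> borel_measurable M" if "i \<in> I" for i using Xm[OF that] by simp
  have "indep_vars (\<lambda>_. borel) (\<lambda>i \<omega>. v i * X i \<omega>) I"
    by (rule indep_vars_compose2[OF indep]) auto
  from char_distr_sum[OF this, of 1]
  have "joint_char M I X v = (\<Prod>i\<in>I. char (distr M borel (\<lambda>\<omega>. v i * X i \<omega>)) 1)"
    unfolding joint_char_def using vm by (simp add: char_def integral_distr)
  also have "\<dots> = (\<Prod>i\<in>I. complex_of_real (exp (- (v i * \<sigma>)\<^sup>2 / 2)))"
  proof (rule prod.cong)
    fix i assume i: "i \<in> I"
    have "char (distr M borel (\<lambda>\<omega>. v i * X i \<omega>)) 1 = (CLINT \<omega>|M. iexp (v i * X i \<omega>))"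
      using vm[OF i] by (simp add: char_def integral_distr)
    then show "char (distr M borel (\<lambda>\<omega>. v i * X i \<omega>)) 1 = complex_of_real (exp (- (v i * \<sigma>)\<^sup>2 / 2))"
      using distributed_normal_char[OF M X[OF i] \<sigma>, of "v i"] by simp
  qed simp
  also have "\<dots> = complex_of_real (exp (\<Sum>i\<in>I. - (v i * \<sigma>)\<^sup>2 / 2))"
    using I by (simp only: exp_sum of_real_prod)
  also have "(\<Sum>i\<in>I. - (v i * \<sigma>)\<^sup>2 / 2) = - (\<Sum>i\<in>I. \<Sum>j\<in>I. v i * v j * (if i = j then \<sigma>\<^sup>2 else 0)) / 2"
    using I by (simp add: if_distrib[of "\<lambda>x. _ * x"] sum_divide_distrib[symmetric] sum_negf power2_eq_square ac_simps cong: if_cong)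
  finally show "joint_char M I X v = complex_of_real (exp (- (\<Sum>i\<in>I. \<Sum>j\<in>I. v i * v j * (if i = j then \<sigma>\<^sup>2 else 0)) / 2))" .
qed (use M I in auto)

text \<open>The joint characteristic function at \<open>v\<close> is the ordinary one, at 1, of the
  linear combination with coefficients \<open>v\<close>, whose law \<open>gaussian_vec\<close>
  prescribes.\<close>

lemma gaussian_vec_family:
  assumes N: "prob_space N" and Z: "gaussian_vec N Z p C"
    and sym: "\<And>i j. i < p \<Longrightarrow> j < p \<Longrightarrow> C $$ (i, j) = C $$ (j, i)"
    and psd: "\<And>v. 0 \<le> (\<Sum>i<p. \<Sum>j<p. v i * C $$ (i, j) * v j)"
  shows "gaussian_family N {..<p} (\<lambda>j \<omega>. Z \<omega> j) (\<lambda>i j. C $$ (i, j))"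
  unfolding gaussian_family_def
proof (intro conjI ballI allI)
  show Zm: "(\<lambda>\<omega>. Z \<omega> j) \<in> borel_measurable N" if "j \<in> {..<p}" for j
    using Z that by (simp add: gaussian_vec_def)
  fix v :: "nat \<Rightarrow> real"
  have "(\<lambda>\<omega>. \<Sum>j<p. v j * Z \<omega> j) \<in> borel_measurable N"
    by (intro borel_measurable_sum borel_measurable_times borel_measurable_const Zm)
  note [measurable] = this
  have "joint_char N {..<p} (\<lambda>j \<omega>. Z \<omega> j) v = (CLINT x|distr N lborel (\<lambda>\<omega>. \<Sum>j<p. v j * Z \<omega> j). iexp x)"
    unfolding joint_char_def by (subst integral_distr) auto
  also have "distr N lborel (\<lambda>\<omega>. \<Sum>j<p. v j * Z \<omega> j) = normal_law 0 (\<Sum>i<p. \<Sum>j<p. v i * C $$ (i, j) * v j)"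
    using Z by (simp add: gaussian_vec_def)
  finally show "joint_char N {..<p} (\<lambda>j \<omega>. Z \<omega> j) v = complex_of_real (exp (- (\<Sum>i<p. \<Sum>j<p. v i * v j * C $$ (i, j)) / 2))"
    unfolding char_normal_law[OF psd] by (simp add: ac_simps)
qed (use N sym in auto)

lemma gaussian_family_single:
  assumes N: "prob_space N" and W: "distributed N lborel W (\<lambda>x. ennreal (std_normal_density x))" and R: "R j j = 1"
  shows "gaussian_family N {j} (\<lambda>_. W) R"
proof -
  have "W \<in> borel_measurable N" using W by (simp add: distributed_def)
  moreover have "joint_char N {j} (\<lambda>_. W) v = complex_of_real (exp (- (v j * v j) / 2))" for v
    using distributed_normal_char[OF N W, of "v j"] by (simp add: joint_char_def power2_eq_square)
  ultimately show ?thesis using N R by (simp add: gaussian_family_def)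
qed

text \<open>Both families have covariance \<open>R\<close>, so complements of box events have equal
  probabilities and the lowered threshold can be carried over to \<open>N\<close>. There
  anti-concentration raises it back to \<open>u\<close>.\<close>

lemma gaussian_abs_max_comparison:
  assumes gM: "gaussian_family M G \<xi> R" and gN: "gaussian_family N G \<zeta> R"
    and R1: "\<And>j. j \<in> G \<Longrightarrow> R j j = 1" and \<Delta>: "\<And>j. j \<in> G \<Longrightarrow> 0 \<le> \<Delta> j"
    and u: "0 \<le> u" and m: "0 < m"
  shows "measure M {\<omega> \<in> space M. \<exists>j\<in>G. u - 1 / real m < \<bar>\<xi> j \<omega>\<bar> + \<Delta> j}
    \<le> measure N {\<omega> \<in> space N. \<exists>j\<in>G. u < \<bar>\<zeta> j \<omega>\<bar> + \<Delta> j} + exp (u + 1/2) / m"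
proof -
  note D = gaussian_familyD[OF gM] and E = gaussian_familyD[OF gN]
  interpret M: prob_space M by (rule D)
  interpret N: prob_space N by (rule E)
  note [measurable] = D(3) E(3)
  have fin: "finite G" by (rule D)
  let ?s = "u - 1 / real m"
  have Mm: "{\<omega> \<in> space M. \<exists>j\<in>G. s < \<bar>\<xi> j \<omega>\<bar> + \<Delta> j} \<in> sets M" for s
    using fin by measurable
  have Nm: "{\<omega> \<in> space N. \<exists>j\<in>G. s < \<bar>\<zeta> j \<omega>\<bar> + \<Delta> j} \<in> sets N" for s
    using fin by measurable
  have box: "measure M {\<omega> \<in> space M. \<forall>j\<in>G. \<xi> j \<omega> \<in> {x. \<bar>x\<bar> + \<Delta> j \<le> ?s}}
      = measure N {\<omega> \<in> space N. \<forall>j\<in>G. \<zeta> j \<omega> \<in> {x. \<bar>x\<bar> + \<Delta> j \<le> ?s}}"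
    by (rule gaussian_family_box_eq[OF gM gN]) auto
  have "measure M {\<omega> \<in> space M. \<exists>j\<in>G. ?s < \<bar>\<xi> j \<omega>\<bar> + \<Delta> j}
      = 1 - measure M (space M - {\<omega> \<in> space M. \<exists>j\<in>G. ?s < \<bar>\<xi> j \<omega>\<bar> + \<Delta> j})"
    by (simp add: M.prob_compl[OF Mm])
  also have "space M - {\<omega> \<in> space M. \<exists>j\<in>G. ?s < \<bar>\<xi> j \<omega>\<bar> + \<Delta> j} = {\<omega> \<in> space M. \<forall>j\<in>G. \<xi> j \<omega> \<in> {x. \<bar>x\<bar> + \<Delta> j \<le> ?s}}"
    by (auto simp: not_less)
  also note box
  also have "{\<omega> \<in> space N. \<forall>j\<in>G. \<zeta> j \<omega> \<in> {x. \<bar>x\<bar> + \<Delta> j \<le> ?s}} = space N - {\<omega> \<in> space N. \<exists>j\<in>G. ?s < \<bar>\<zeta> j \<omega>\<bar> + \<Delta> j}"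
    by (auto simp: not_less)
  also have "1 - measure N \<dots> = measure N {\<omega> \<in> space N. \<exists>j\<in>G. ?s < \<bar>\<zeta> j \<omega>\<bar> + \<Delta> j}"
    by (simp add: N.prob_compl[OF Nm])
  finally have 1: "measure M {\<omega> \<in> space M. \<exists>j\<in>G. ?s < \<bar>\<xi> j \<omega>\<bar> + \<Delta> j} = measure N {\<omega> \<in> space N. \<exists>j\<in>G. ?s < \<bar>\<zeta> j \<omega>\<bar> + \<Delta> j}" .
  \<comment> \<open>Signed copies of the indices: an absolute value is the maximum of the two signed
    values, so the event concerns a maximum of unit-variance Gaussians with constants
    \<open>u - \<Delta> j\<close>.\<close>
  define K where "K = G \<times> {1, -1 :: real}"
  define A where "A k i = (if i = fst k then snd k else 0)" for k :: "'b \<times> real" and i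
  have finK: "finite K" using fin by (simp add: K_def)
  define \<eta> where "\<eta> k \<omega> = (\<Sum>i\<in>G. A k i * \<zeta> i \<omega>)" for k \<omega>
  define R' where "R' j k = (\<Sum>i\<in>G. \<Sum>i'\<in>G. A j i * A k i' * R i i')" for j k
  have gK: "gaussian_family N K \<eta> R'"
    using gaussian_family_linear[OF gN finK, of A] unfolding \<eta>_def[abs_def] R'_def[abs_def] .
  have A_sum: "(\<Sum>i\<in>G. A k i * f i) = snd k * f (fst k)" if "k \<in> K" for k f
    using that fin by (auto simp: A_def K_def if_distrib[of "\<lambda>x. x * _"] cong: if_cong)
  have \<eta>: "\<eta> k \<omega> = snd k * \<zeta> (fst k) \<omega>" if "k \<in> K" for k \<omega>
    unfolding \<eta>_def by (rule A_sum[OF that])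
  have R'1: "R' k k = 1" if "k \<in> K" for k
  proof -
    have "R' k k = (\<Sum>i\<in>G. A k i * (\<Sum>i'\<in>G. A k i' * R i i'))"
      unfolding R'_def by (simp add: sum_distrib_left ac_simps)
    also have "\<dots> = snd k * (snd k * R (fst k) (fst k))" unfolding A_sum[OF that] ..
    finally show ?thesis using that R1 by (auto simp: K_def)
  qed
  have anti: "measure N {\<omega> \<in> space N. (\<exists>k\<in>K. (u - \<Delta> (fst k)) - 1 / real m < \<eta> k \<omega>) \<and> (\<forall>k\<in>K. \<eta> k \<omega> \<le> u - \<Delta> (fst k))} \<le> exp (u + 1/2) / m"
    by (rule gaussian_max_anticoncentration[OF gK R'1 _ u m]) (use \<Delta> in \<open>auto simp: K_def\<close>)
  have abs_gt: "(\<exists>k\<in>K. (u - \<Delta> (fst k)) - 1 / real m < \<eta> k \<omega>) \<longleftrightarrow> (\<exists>j\<in>G. ?s < \<bar>\<zeta> j \<omega>\<bar> + \<Delta> j)" for \<omega>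
  proof -
    have "(\<exists>k\<in>K. (u - \<Delta> (fst k)) - 1 / real m < \<eta> k \<omega>) \<longleftrightarrow> (\<exists>k\<in>K. (u - \<Delta> (fst k)) - 1 / real m < snd k * \<zeta> (fst k) \<omega>)"
      by (intro bex_cong refl) (simp add: \<eta>)
    also have "\<dots> \<longleftrightarrow> (\<exists>j\<in>G. (u - \<Delta> j) - 1 / real m < \<zeta> j \<omega> \<or> (u - \<Delta> j) - 1 / real m < - \<zeta> j \<omega>)"
      by (auto simp: K_def)
    also have "\<dots> \<longleftrightarrow> (\<exists>j\<in>G. ?s < \<bar>\<zeta> j \<omega>\<bar> + \<Delta> j)"
      by (intro bex_cong refl) arith
    finally show ?thesis .
  qed
  have abs_le: "(\<forall>k\<in>K. \<eta> k \<omega> \<le> u - \<Delta> (fst k)) \<longleftrightarrow> (\<forall>j\<in>G. \<bar>\<zeta> j \<omega>\<bar> + \<Delta> j \<le> u)" for \<omega>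
  proof -
    have "(\<forall>k\<in>K. \<eta> k \<omega> \<le> u - \<Delta> (fst k)) \<longleftrightarrow> (\<forall>k\<in>K. snd k * \<zeta> (fst k) \<omega> \<le> u - \<Delta> (fst k))"
      by (intro ball_cong refl) (simp add: \<eta>)
    also have "\<dots> \<longleftrightarrow> (\<forall>j\<in>G. \<zeta> j \<omega> \<le> u - \<Delta> j \<and> - \<zeta> j \<omega> \<le> u - \<Delta> j)"
      by (auto simp: K_def)
    also have "\<dots> \<longleftrightarrow> (\<forall>j\<in>G. \<bar>\<zeta> j \<omega>\<bar> + \<Delta> j \<le> u)"
      by (intro ball_cong refl) arith
    finally show ?thesis .
  qed
  let ?E = "{\<omega> \<in> space N. (\<exists>j\<in>G. ?s < \<bar>\<zeta> j \<omega>\<bar> + \<Delta> j) \<and> (\<forall>j\<in>G. \<bar>\<zeta> j \<omega>\<bar> + \<Delta> j \<le> u)}"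
  have Em: "?E \<in> sets N" using fin by measurable
  have "measure N {\<omega> \<in> space N. \<exists>j\<in>G. ?s < \<bar>\<zeta> j \<omega>\<bar> + \<Delta> j} \<le> measure N ({\<omega> \<in> space N. \<exists>j\<in>G. u < \<bar>\<zeta> j \<omega>\<bar> + \<Delta> j} \<union> ?E)"
    by (rule N.finite_measure_mono) (use Nm[of u] Em in \<open>auto simp: not_less\<close>)
  also have "\<dots> \<le> measure N {\<omega> \<in> space N. \<exists>j\<in>G. u < \<bar>\<zeta> j \<omega>\<bar> + \<Delta> j} + measure N ?E"
    by (rule measure_Un_le[OF Nm Em])
  also have "measure N ?E \<le> exp (u + 1/2) / m" using anti unfolding abs_gt abs_le .
  finally show ?thesis unfolding 1 by simp
qed

section \<open>Tail bound for a fixed sample size\<close>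

text \<open>Since \<open>b $ j = 0\<close>, coordinate \<open>j\<close> of the projected vector is a
  sum over the other coordinates alone. The correction subtracts its estimate, so only the error of
  the initial estimator remains.\<close>

lemma ridge_corr_expansion:
  fixes X :: "real mat" and b e :: "real vec"
  assumes X: "X \<in> carrier_mat n p" and n: "n \<ge> 1" and lam: "lam > 0"
    and b: "b \<in> carrier_vec p" and j: "j < p" and bj: "b $ j = 0" and e: "e \<in> carrier_vec n"
  shows "ridge_corr X lam (X *\<^sub>v b + e) binit j =
    (\<Sum>i<n. ((1 / real n) \<cdot>\<^sub>m (ridge_mat X lam * transpose_mat X)) $$ (j, i) * e $ i)
    - lam * (ridge_mat X lam *\<^sub>v (proj_X X *\<^sub>v b)) $ j
    - (\<Sum>k\<in>{..<p} - {j}. proj_X X $$ (j, k) * (binit k - b $ k))"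
proof -
  have dims: "dim_col X = p" using X by simp
  have "(proj_X X *\<^sub>v b) $ j = (\<Sum>k<p. proj_X X $$ (j, k) * b $ k)"
    using proj_X(1)[OF X] b j by (auto simp: scalar_prod_def atLeast0LessThan)
  also have "\<dots> = (\<Sum>k\<in>{..<p} - {j}. proj_X X $$ (j, k) * b $ k)"
    using j bj by (simp add: sum.remove[of "{..<p}" j])
  finally show ?thesis
    unfolding ridge_corr_def ridge_decomposition[OF X n lam b e j] dims
    by (simp add: right_diff_distrib sum_subtractf)
qed

text \<open>The upper bound is free of \<open>j\<close>, which makes the bias bound uniform over the
  coordinates; the last equation is the unit variance that anti-concentration requires.\<close>

lemma a_fac_bounds:
  assumes X: "X \<in> carrier_mat n p" and n: "n \<ge> 1" and \<sigma>: "\<sigma> > 0" and j: "j < p" and O: "Omega_min X lam > 0"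
  shows "0 < a_fac X lam \<sigma> j" "a_fac X lam \<sigma> j \<le> sqrt (real n) / \<sigma> / sqrt (Omega_min X lam)"
    "a_fac X lam \<sigma> j * a_fac X lam \<sigma> j * (\<sigma>\<^sup>2 / real n * Omega X lam $$ (j, j)) = 1"
proof -
  have dims: "dim_col X = p" "dim_row X = n" using X by auto
  have le: "Omega_min X lam \<le> Omega X lam $$ (j, j)"
    unfolding Omega_min_def using j dims by (intro Min_le) auto
  then have pos: "Omega X lam $$ (j, j) > 0" using O by linarith
  show "0 < a_fac X lam \<sigma> j" using pos \<sigma> n by (simp add: a_fac_def dims)
  show "a_fac X lam \<sigma> j \<le> sqrt (real n) / \<sigma> / sqrt (Omega_min X lam)"
    unfolding a_fac_def dims using le O \<sigma> by (intro divide_left_mono) auto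
  have "a_fac X lam \<sigma> j * a_fac X lam \<sigma> j = real n / \<sigma>\<^sup>2 / Omega X lam $$ (j, j)"
    using pos by (simp add: a_fac_def dims power2_eq_square)
  then show "a_fac X lam \<sigma> j * a_fac X lam \<sigma> j * (\<sigma>\<^sup>2 / real n * Omega X lam $$ (j, j)) = 1"
    using pos \<sigma> n by simp
qed

text \<open>The three losses are kept apart: failure of the event controlling the initial estimator,
  the bias, which costs \<open>1 / m\<close> in the threshold, and the return to the threshold
  \<open>u\<close> by anti-concentration.\<close>

lemma ridge_corr_tail_bound:
  fixes X :: "real mat" and b :: "real vec" and \<epsilon> :: "'a \<Rightarrow> nat \<Rightarrow> real" and binit :: "'a \<Rightarrow> nat \<Rightarrow> real" and m :: nat
  assumes M: "prob_space M" and X: "X \<in> carrier_mat n p" and n: "n \<ge> 1" and b: "b \<in> carrier_vec p"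
    and \<sigma>: "\<sigma> > 0" and lam: "lam > 0" and O: "Omega_min X lam > 0"
    and indep: "prob_space.indep_vars M (\<lambda>_. borel) (\<lambda>i \<omega>. \<epsilon> \<omega> i) {..<n}"
    and normal: "\<And>i. i < n \<Longrightarrow> distributed M lborel (\<lambda>\<omega>. \<epsilon> \<omega> i) (\<lambda>x. ennreal (normal_density 0 \<sigma> x))"
    and binit[measurable]: "\<And>k. k < p \<Longrightarrow> (\<lambda>\<omega>. binit \<omega> k) \<in> borel_measurable M"
    and \<Delta>: "\<And>j. j < p \<Longrightarrow> \<Delta> j > 0"
    and G: "G \<subseteq> {..<p}" "\<And>j. j \<in> G \<Longrightarrow> b $ j = 0"
    and rate: "sqrt (real n) * norm2 (proj_X X *\<^sub>v b) * lam / sqrt (Omega_min X lam) / lambda_min_nz (Sigma_hat X) \<le> \<sigma> / m"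
    and u: "u > 0" and m: "m > 0"
    and \<zeta>: "gaussian_family N G \<zeta> (\<lambda>j k. a_fac X lam \<sigma> j * a_fac X lam \<sigma> k * (\<sigma>\<^sup>2 / real n * Omega X lam $$ (j, k)))"
  shows "measure M {\<omega> \<in> space M. \<exists>j\<in>G. u < a_fac X lam \<sigma> j * \<bar>ridge_corr X lam (X *\<^sub>v b + vec n (\<epsilon> \<omega>)) (binit \<omega>) j\<bar>}
    \<le> (1 - measure M {\<omega> \<in> space M. \<forall>j<p. \<bar>a_fac X lam \<sigma> j *
           (\<Sum>k\<in>{..<p} - {j}. proj_X X $$ (j, k) * (binit \<omega> k - b $ k))\<bar> \<le> \<Delta> j})
      + measure N {\<omega> \<in> space N. \<exists>j\<in>G. u < \<bar>\<zeta> j \<omega>\<bar> + \<Delta> j} + exp (u + 1/2) / m"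
proof -
  interpret prob_space M by fact
  define T where "T = (1 / real n) \<cdot>\<^sub>m (ridge_mat X lam * transpose_mat X)"
  define a where "a j = a_fac X lam \<sigma> j" for j
  define R where "R j k = a j * a k * (\<sigma>\<^sup>2 / real n * Omega X lam $$ (j, k))" for j k
  define \<xi> where "\<xi> j \<omega> = (\<Sum>i<n. (a j * T $$ (j, i)) * \<epsilon> \<omega> i)" for j \<omega>
  note ab = a_fac_bounds[OF X n \<sigma> _ O, folded a_def]
  have finG: "finite G" using G(1) finite_subset by blast
  have iid: "gaussian_family M {..<n} (\<lambda>i \<omega>. \<epsilon> \<omega> i) (\<lambda>i j. if i = j then \<sigma>\<^sup>2 else 0)"
    by (rule gaussian_family_iid[OF M \<sigma> _ indep]) (use normal in auto)
  have gL: "gaussian_family M G \<xi> (\<lambda>j k. \<Sum>i<n. \<Sum>i'<n. (a j * T $$ (j, i)) * (a k * T $$ (k, i')) * (if i = i' then \<sigma>\<^sup>2 else 0))"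
    using gaussian_family_linear[OF iid finG, of "\<lambda>j i. a j * T $$ (j, i)"] unfolding \<xi>_def[abs_def] .
  have cov: "(\<Sum>i<n. \<Sum>i'<n. (a j * T $$ (j, i)) * (a k * T $$ (k, i')) * (if i = i' then \<sigma>\<^sup>2 else 0)) = R j k"
    if "j \<in> G" "k \<in> G" for j k
  proof -
    have "(\<Sum>i<n. \<Sum>i'<n. (a j * T $$ (j, i)) * (a k * T $$ (k, i')) * (if i = i' then \<sigma>\<^sup>2 else 0))
        = (\<Sum>i<n. (a j * a k * \<sigma>\<^sup>2) * (T $$ (j, i) * T $$ (k, i)))"
      by (intro sum.cong refl) (simp add: if_distrib[of "\<lambda>x. _ * x"] ac_simps cong: if_cong)
    also have "\<dots> = a j * a k * \<sigma>\<^sup>2 * (Omega X lam $$ (j, k) / real n)"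
      unfolding sum_distrib_left[symmetric] T_def using that G(1)
      by (subst ridge_noise_covariance[OF X n lam]) auto
    finally show ?thesis by (simp add: R_def)
  qed
  have g\<xi>: "gaussian_family M G \<xi> R"
    using gL cov unfolding gaussian_family_def by (auto cong: sum.cong)
  have g\<zeta>: "gaussian_family N G \<zeta> R" using \<zeta> unfolding R_def[abs_def] a_def[abs_def] .
  have R1: "R j j = 1" if "j \<in> G" for j using ab(3)[of j] that G(1) by (auto simp: R_def)
  note [measurable] = gaussian_familyD(3)[OF g\<xi>]
  let ?A = "{\<omega> \<in> space M. \<forall>j<p. \<bar>a j * (\<Sum>k\<in>{..<p} - {j}. proj_X X $$ (j, k) * (binit \<omega> k - b $ k))\<bar> \<le> \<Delta> j}"
  let ?B = "{\<omega> \<in> space M. \<exists>j\<in>G. u - 1 / real m < \<bar>\<xi> j \<omega>\<bar> + \<Delta> j}"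
  let ?E = "{\<omega> \<in> space M. \<exists>j\<in>G. u < a j * \<bar>ridge_corr X lam (X *\<^sub>v b + vec n (\<epsilon> \<omega>)) (binit \<omega>) j\<bar>}"
  have Am: "?A \<in> sets M"
  proof -
    have [measurable]: "(\<lambda>\<omega>. binit \<omega> k) \<in> borel_measurable M" if "k \<in> {..<p} - {j}" for k j using binit that by auto
    show ?thesis by measurable
  qed
  have Bm: "?B \<in> sets M" using finG by measurable
  \<comment> \<open>On \<open>?A\<close> the initial-estimator term is at most
    \<open>\<Delta> j\<close> and the bias at most \<open>1 / m\<close>, so exceeding
    \<open>u\<close> forces the noise term to make up the rest.\<close>
  have "?E \<subseteq> (space M - ?A) \<union> ?B"
  proof
    fix \<omega> assume w: "\<omega> \<in> ?E"
    then obtain j where j: "j \<in> G" "u < a j * \<bar>ridge_corr X lam (X *\<^sub>v b + vec n (\<epsilon> \<omega>)) (binit \<omega>) j\<bar>" by blast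
    have jp: "j < p" using j G(1) by auto
    define d where "d = (ridge_mat X lam *\<^sub>v (proj_X X *\<^sub>v b)) $ j"
    define s where "s = (\<Sum>k\<in>{..<p} - {j}. proj_X X $$ (j, k) * (binit \<omega> k - b $ k))"
    have apos: "a j > 0" by (rule ab(1)[OF jp])
    have "a j * ridge_corr X lam (X *\<^sub>v b + vec n (\<epsilon> \<omega>)) (binit \<omega>) j = \<xi> j \<omega> - a j * (lam * d) - a j * s"
      by (subst ridge_corr_expansion[OF X n lam b jp G(2)[OF j(1)]])
        (simp_all add: \<xi>_def T_def[symmetric] d_def s_def right_diff_distrib sum_distrib_left ac_simps)
    then have eq: "a j * \<bar>ridge_corr X lam (X *\<^sub>v b + vec n (\<epsilon> \<omega>)) (binit \<omega>) j\<bar> = \<bar>\<xi> j \<omega> - a j * (lam * d) - a j * s\<bar>"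
      using apos by (metis abs_mult abs_of_pos)
    have "\<bar>a j * (lam * d)\<bar> = a j * (lam * \<bar>d\<bar>)" using apos lam by (simp add: abs_mult)
    also have "\<dots> \<le> (sqrt (real n) / \<sigma> / sqrt (Omega_min X lam)) * (lam * (norm2 (proj_X X *\<^sub>v b) / lambda_min_nz (Sigma_hat X)))"
      using ab(2)[OF jp] ridge_bias_bound[OF X n lam b jp] lam apos O \<sigma>
      by (intro mult_mono) (auto simp: d_def)
    also have "\<dots> = (sqrt (real n) * norm2 (proj_X X *\<^sub>v b) * lam / sqrt (Omega_min X lam) / lambda_min_nz (Sigma_hat X)) / \<sigma>"
      by (simp add: field_simps)
    also have "\<dots> \<le> (\<sigma> / m) / \<sigma>" using rate \<sigma> by (intro divide_right_mono) auto
    also have "\<dots> = 1 / m" using \<sigma> by simp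
    finally have bias: "\<bar>a j * (lam * d)\<bar> \<le> 1 / m" .
    show "\<omega> \<in> (space M - ?A) \<union> ?B"
    proof (cases "\<omega> \<in> ?A")
      case True
      then have "\<bar>a j * s\<bar> \<le> \<Delta> j" using jp by (auto simp: s_def)
      then have "u - 1 / real m < \<bar>\<xi> j \<omega>\<bar> + \<Delta> j" using j(2) bias unfolding eq by linarith
      then show ?thesis using w j(1) by blast
    qed (use w in blast)
  qed
  then have "measure M ?E \<le> measure M ((space M - ?A) \<union> ?B)"
    by (rule finite_measure_mono) (use Am Bm in auto)
  also have "\<dots> \<le> measure M (space M - ?A) + measure M ?B"
    by (rule measure_Un_le) (use Am Bm in auto)
  also have "measure M (space M - ?A) = 1 - measure M ?A" by (rule prob_compl[OF Am])
  also have "measure M ?B \<le> measure N {\<omega> \<in> space N. \<exists>j\<in>G. u < \<bar>\<zeta> j \<omega>\<bar> + \<Delta> j} + exp (u + 1/2) / m"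
    by (rule gaussian_abs_max_comparison[OF g\<xi> g\<zeta> R1 _ _ m]) (use \<Delta> G(1) u in \<open>auto intro: less_imp_le\<close>)
  finally show ?thesis unfolding a_def by (simp add: add.assoc)
qed

section \<open>Passage to the limit\<close>

lemma limsup_le_zeroI:
  fixes x :: "nat \<Rightarrow> real"
  assumes "\<And>e. e > 0 \<Longrightarrow> eventually (\<lambda>n. x n \<le> e) sequentially"
  shows "limsup (\<lambda>n. ereal (x n)) \<le> 0"
proof (rule ereal_le_epsilon2)
  fix e :: real assume "0 < e"
  then have "limsup (\<lambda>n. ereal (x n)) \<le> ereal e"
    by (intro Limsup_bounded eventually_mono[OF assms]) auto
  then show "limsup (\<lambda>n. ereal (x n)) \<le> 0 + ereal e" by simp
qed

lemma Omega_carrier: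
  assumes X: "X \<in> carrier_mat n p" and n: "n \<ge> 1" and lam: "lam > 0"
  shows "Omega X lam \<in> carrier_mat p p"
  using ridge_mat_inverse(1)[OF X n lam] Sigma_hat(1)[OF X] X
  unfolding Omega_def ridge_mat_def Let_def by auto

lemma scaled_Omega_symmetric:
  assumes X: "X \<in> carrier_mat n p" and n: "n \<ge> 1" and lam: "lam > 0" and ij: "i < p" "j < p"
  shows "(c \<cdot>\<^sub>m Omega X lam) $$ (i, j) = (c \<cdot>\<^sub>m Omega X lam) $$ (j, i)"
proof -
  have "Omega X lam $$ (i, j) / real n = Omega X lam $$ (j, i) / real n"
    unfolding ridge_noise_covariance[OF X n lam ij, symmetric] ridge_noise_covariance[OF X n lam ij(2,1), symmetric]
    by (simp add: mult.commute)
  then show ?thesis using ij n Omega_carrier[OF X n lam] by simp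
qed

text \<open>By \<open>ridge_noise_covariance\<close> the form is \<sigma> squared times a sum of
  squares, one for each observation.\<close>

lemma scaled_Omega_nonneg:
  assumes X: "X \<in> carrier_mat n p" and n: "n \<ge> 1" and lam: "lam > 0"
  shows "0 \<le> (\<Sum>i<p. \<Sum>j<p. v i * ((\<sigma>\<^sup>2 / real n) \<cdot>\<^sub>m Omega X lam) $$ (i, j) * v j)"
proof -
  define T where "T = (1 / real n) \<cdot>\<^sub>m (ridge_mat X lam * transpose_mat X)"
  have "(\<Sum>i<p. \<Sum>j<p. v i * ((\<sigma>\<^sup>2 / real n) \<cdot>\<^sub>m Omega X lam) $$ (i, j) * v j)
      = (\<Sum>i<p. \<Sum>j<p. \<Sum>l<n. \<sigma>\<^sup>2 * ((v i * T $$ (i, l)) * (v j * T $$ (j, l))))"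
  proof (intro sum.cong refl)
    fix i j assume ij: "i \<in> {..<p}" "j \<in> {..<p}"
    have "v i * ((\<sigma>\<^sup>2 / real n) \<cdot>\<^sub>m Omega X lam) $$ (i, j) * v j = \<sigma>\<^sup>2 * v i * v j * (Omega X lam $$ (i, j) / real n)"
      using ij Omega_carrier[OF X n lam] by simp
    also have "\<dots> = (\<Sum>l<n. \<sigma>\<^sup>2 * ((v i * T $$ (i, l)) * (v j * T $$ (j, l))))"
      using ridge_noise_covariance[OF X n lam, of i j, symmetric] ij
      by (simp only: T_def lessThan_iff sum_distrib_left) (simp add: ac_simps)
    finally show "v i * ((\<sigma>\<^sup>2 / real n) \<cdot>\<^sub>m Omega X lam) $$ (i, j) * v j = (\<Sum>l<n. \<sigma>\<^sup>2 * ((v i * T $$ (i, l)) * (v j * T $$ (j, l))))" .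
  qed
  also have "\<dots> = (\<Sum>l<n. \<sigma>\<^sup>2 * (\<Sum>i<p. v i * T $$ (i, l))\<^sup>2)"
  proof -
    have "(\<Sum>l<n. \<sigma>\<^sup>2 * (\<Sum>i<p. v i * T $$ (i, l))\<^sup>2)
       = (\<Sum>l<n. \<Sum>i<p. \<Sum>j<p. \<sigma>\<^sup>2 * ((v i * T $$ (i, l)) * (v j * T $$ (j, l))))"
      by (simp only: power2_eq_square[of "sum _ _"] sum_product, simp only: sum_distrib_left)
    also have "\<dots> = (\<Sum>i<p. \<Sum>l<n. \<Sum>j<p. \<sigma>\<^sup>2 * ((v i * T $$ (i, l)) * (v j * T $$ (j, l))))"
      by (rule sum.swap)
    also have "\<dots> = (\<Sum>i<p. \<Sum>j<p. \<Sum>l<n. \<sigma>\<^sup>2 * ((v i * T $$ (i, l)) * (v j * T $$ (j, l))))"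
      by (rule sum.cong[OF refl], rule sum.swap)
    finally show ?thesis by simp
  qed
  also have "\<dots> \<ge> 0" by (intro sum_nonneg mult_nonneg_nonneg) auto
  finally show ?thesis .
qed

theorem theorem1:
  fixes M :: "'a measure" and p :: "nat \<Rightarrow> nat" and X :: "nat \<Rightarrow> real mat"
    and beta0 :: "nat \<Rightarrow> real vec" and eps :: "nat \<Rightarrow> 'a \<Rightarrow> nat \<Rightarrow> real"
    and \<sigma> :: real and lam :: "nat \<Rightarrow> real" and binit :: "nat \<Rightarrow> 'a \<Rightarrow> nat \<Rightarrow> real"
    and Delta :: "nat \<Rightarrow> nat \<Rightarrow> real"
  defines "Y \<equiv> (\<lambda>n \<omega>. X n *\<^sub>v beta0 n + vec n (eps n \<omega>))"
  assumes M: "prob_space M"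
    and p_pos: "\<And>n. n \<ge> 1 \<Longrightarrow> p n \<ge> 1"
    and X_dim: "\<And>n. n \<ge> 1 \<Longrightarrow> X n \<in> carrier_mat n (p n)"
    and beta0_dim: "\<And>n. n \<ge> 1 \<Longrightarrow> beta0 n \<in> carrier_vec (p n)"
    and sigma_pos: "\<sigma> > 0"
    and eps_indep: "\<And>n. n \<ge> 1 \<Longrightarrow> prob_space.indep_vars M (\<lambda>_. borel) (\<lambda>i \<omega>. eps n \<omega> i) {..<n}"
    and eps_normal: "\<And>n i. n \<ge> 1 \<Longrightarrow> i < n \<Longrightarrow>
          distributed M lborel (\<lambda>\<omega>. eps n \<omega> i) (\<lambda>x. ennreal (normal_density 0 \<sigma> x))"
    and lam_pos: "\<And>n. n \<ge> 1 \<Longrightarrow> lam n > 0"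
    and Omin_pos: "\<And>n. n \<ge> 1 \<Longrightarrow> Omega_min (X n) (lam n) > 0"
    and rate: "(\<lambda>n. sqrt (real n) * norm2 (proj_X (X n) *\<^sub>v beta0 n) * lam n
                 / sqrt (Omega_min (X n) (lam n)) / lambda_min_nz (Sigma_hat (X n))) \<longlonglongrightarrow> 0"
    and binit_meas: "\<And>n k. n \<ge> 1 \<Longrightarrow> k < p n \<Longrightarrow> (\<lambda>\<omega>. binit n \<omega> k) \<in> borel_measurable M"
    and Delta_pos: "\<And>n j. n \<ge> 1 \<Longrightarrow> j < p n \<Longrightarrow> Delta n j > 0"
    and A: "(\<lambda>n. measure M {\<omega> \<in> space M. \<forall>j<p n.
               \<bar>a_fac (X n) (lam n) \<sigma> j *
                 (\<Sum>k\<in>{..<p n} - {j}. proj_X (X n) $$ (j, k) * (binit n \<omega> k - beta0 n $ k))\<bar>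
               \<le> Delta n j}) \<longlonglongrightarrow> 1"
  shows
    "(\<forall>(jj :: nat \<Rightarrow> nat) (u :: real) (N :: 'b measure) (W :: 'b \<Rightarrow> real).
        (\<forall>n\<ge>1. jj n < p n \<and> beta0 n $ jj n = 0) \<and> u > 0 \<and> prob_space N \<and>
        distributed N lborel W (\<lambda>x. ennreal (std_normal_density x)) \<longrightarrow>
        limsup (\<lambda>n. ereal (
           measure M {\<omega> \<in> space M. a_fac (X n) (lam n) \<sigma> (jj n) *
                \<bar>ridge_corr (X n) (lam n) (Y n \<omega>) (binit n \<omega>) (jj n)\<bar> > u}
         - measure N {w \<in> space N. \<bar>W w\<bar> + Delta n (jj n) > u})) \<le> 0)
   \<and>
    (\<forall>(G :: nat \<Rightarrow> nat set) (u :: real) (N :: 'c measure) (Z :: nat \<Rightarrow> 'c \<Rightarrow> nat \<Rightarrow> real).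
        (\<forall>n\<ge>1. G n \<subseteq> {..<p n} \<and> (\<forall>j\<in>G n. beta0 n $ j = 0)) \<and> u > 0 \<and> prob_space N \<and>
        (\<forall>n\<ge>1. gaussian_vec N (Z n) (p n) ((\<sigma>\<^sup>2 / real n) \<cdot>\<^sub>m Omega (X n) (lam n))) \<longrightarrow>
        limsup (\<lambda>n. ereal (
           measure M {\<omega> \<in> space M. Max ((\<lambda>j. a_fac (X n) (lam n) \<sigma> j *
                \<bar>ridge_corr (X n) (lam n) (Y n \<omega>) (binit n \<omega>) j\<bar>) ` G n) > u}
         - measure N {z \<in> space N. Max ((\<lambda>j. a_fac (X n) (lam n) \<sigma> j * \<bar>Z n z j\<bar> + Delta n j) ` G n) > u}))
        \<le> 0)"
proof -
  \<comment> \<open>The correlation matrix of the noise part of the ridge estimator, shared by the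
    normalized noise and the normalized \<open>Z\<close>.\<close>
  define O' where "O' n j k = a_fac (X n) (lam n) \<sigma> j * a_fac (X n) (lam n) \<sigma> k * (\<sigma>\<^sup>2 / real n * Omega (X n) (lam n) $$ (j, k))" for n j k
  define pA where "pA n = measure M {\<omega> \<in> space M. \<forall>j<p n. \<bar>a_fac (X n) (lam n) \<sigma> j *
      (\<Sum>k\<in>{..<p n} - {j}. proj_X (X n) $$ (j, k) * (binit n \<omega> k - beta0 n $ k))\<bar> \<le> Delta n j}" for n
  have O'1: "O' n j j = 1" if "n \<ge> 1" "j < p n" for n j
    unfolding O'_def by (rule a_fac_bounds(3)[OF X_dim[OF that(1)] that(1) sigma_pos that(2) Omin_pos[OF that(1)]])
  have a_pos: "0 < a_fac (X n) (lam n) \<sigma> j" if "n \<ge> 1" "j < p n" for n j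
    by (rule a_fac_bounds(1)[OF X_dim[OF that(1)] that(1) sigma_pos that(2) Omin_pos[OF that(1)]])
  \<comment> \<open>Common core of both claims. The set \<open>G\<close> and the family
    \<open>\<zeta>\<close> are quantified inside \<open>eventually\<close>, so the threshold for
    \<open>n\<close> is uniform in them; the type of \<open>N\<close> is left generic because the
    two claims use different ones.\<close>
  have asymptotic: "eventually (\<lambda>n. n \<ge> 1 \<and>
      (\<forall>G \<zeta>. G \<subseteq> {..<p n} \<and> (\<forall>j\<in>G. beta0 n $ j = 0) \<and> gaussian_family N G \<zeta> (O' n) \<longrightarrow>
        measure M {\<omega> \<in> space M. \<exists>j\<in>G. u < a_fac (X n) (lam n) \<sigma> j * \<bar>ridge_corr (X n) (lam n) (Y n \<omega>) (binit n \<omega>) j\<bar>}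
        - measure N {\<omega> \<in> space N. \<exists>j\<in>G. u < \<bar>\<zeta> j \<omega>\<bar> + Delta n j} \<le> e)) sequentially"
    if u: "u > 0" and e: "e > 0" for u e :: real and N :: "'z measure"
  proof -
    \<comment> \<open>\<open>m\<close> is fixed before \<open>n\<close> grows: it makes the
      anti-concentration error less than \<open>e / 2\<close>. For this \<open>m\<close> the
      normalized bias is eventually at most \<open>1 / m\<close>, and the failure probability drops
      below \<open>e / 2\<close>.\<close>
    obtain m :: nat where m: "real m > 2 * exp (u + 1/2) / e" using reals_Archimedean2 by blast
    have "2 * exp (u + 1/2) / e > 0" using e by simp
    then have m0: "0 < m" using m by (cases m) auto
    then have me: "exp (u + 1/2) / m < e / 2" using m e by (simp add: field_simps)
    have ev_rate: "eventually (\<lambda>n. sqrt (real n) * norm2 (proj_X (X n) *\<^sub>v beta0 n) * lam n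
        / sqrt (Omega_min (X n) (lam n)) / lambda_min_nz (Sigma_hat (X n)) < \<sigma> / m) sequentially"
      by (rule order_tendstoD(2)[OF rate]) (use sigma_pos m0 in simp)
    have ev_A: "eventually (\<lambda>n. 1 - e / 2 < pA n) sequentially"
      unfolding pA_def by (rule order_tendstoD(1)[OF A]) (use e in simp)
    show ?thesis
      using ev_rate ev_A eventually_ge_at_top[of 1]
    proof eventually_elim
      case (elim n)
      show ?case
      proof (intro conjI allI impI)
        fix G \<zeta> assume h: "G \<subseteq> {..<p n} \<and> (\<forall>j\<in>G. beta0 n $ j = 0) \<and> gaussian_family N G \<zeta> (O' n)"
        have "measure M {\<omega> \<in> space M. \<exists>j\<in>G. u < a_fac (X n) (lam n) \<sigma> j * \<bar>ridge_corr (X n) (lam n) (Y n \<omega>) (binit n \<omega>) j\<bar>}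
          \<le> (1 - pA n) + measure N {\<omega> \<in> space N. \<exists>j\<in>G. u < \<bar>\<zeta> j \<omega>\<bar> + Delta n j} + exp (u + 1/2) / m"
          unfolding Y_def pA_def
          by (rule ridge_corr_tail_bound[OF M X_dim _ beta0_dim sigma_pos lam_pos Omin_pos eps_indep eps_normal binit_meas
                Delta_pos _ _ _ u m0]) (use h elim in \<open>auto simp: O'_def[abs_def]\<close>)
        then show "measure M {\<omega> \<in> space M. \<exists>j\<in>G. u < a_fac (X n) (lam n) \<sigma> j * \<bar>ridge_corr (X n) (lam n) (Y n \<omega>) (binit n \<omega>) j\<bar>}
          - measure N {\<omega> \<in> space N. \<exists>j\<in>G. u < \<bar>\<zeta> j \<omega>\<bar> + Delta n j} \<le> e"
          using elim(2) me by linarith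
      qed (use elim in simp)
    qed
  qed
  show ?thesis
  proof (intro conjI allI impI, goal_cases)
    case (1 jj u N W)
    show ?case
    proof (rule limsup_le_zeroI)
      fix e :: real assume e: "e > 0"
      show "eventually (\<lambda>n. measure M {\<omega> \<in> space M. a_fac (X n) (lam n) \<sigma> (jj n) *
                \<bar>ridge_corr (X n) (lam n) (Y n \<omega>) (binit n \<omega>) (jj n)\<bar> > u}
         - measure N {w \<in> space N. \<bar>W w\<bar> + Delta n (jj n) > u} \<le> e) sequentially"
        using asymptotic[of u e N]
      proof (rule eventually_mono)
        fix n assume n: "n \<ge> 1 \<and>
          (\<forall>G \<zeta>. G \<subseteq> {..<p n} \<and> (\<forall>j\<in>G. beta0 n $ j = 0) \<and> gaussian_family N G \<zeta> (O' n) \<longrightarrow>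
            measure M {\<omega> \<in> space M. \<exists>j\<in>G. u < a_fac (X n) (lam n) \<sigma> j * \<bar>ridge_corr (X n) (lam n) (Y n \<omega>) (binit n \<omega>) j\<bar>}
            - measure N {\<omega> \<in> space N. \<exists>j\<in>G. u < \<bar>\<zeta> j \<omega>\<bar> + Delta n j} \<le> e)"
        then have "jj n < p n" "beta0 n $ jj n = 0" using 1 by auto
        \<comment> \<open>The first claim is the case of a singleton: a single normalized coordinate
          is standard normal, hence \<open>W\<close> serves for every \<open>n\<close>.\<close>
        moreover have "gaussian_family N {jj n} (\<lambda>_. W) (O' n)"
          by (rule gaussian_family_single) (use 1 O'1 n calculation in auto)
        ultimately show "measure M {\<omega> \<in> space M. a_fac (X n) (lam n) \<sigma> (jj n) *
                \<bar>ridge_corr (X n) (lam n) (Y n \<omega>) (binit n \<omega>) (jj n)\<bar> > u}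
         - measure N {w \<in> space N. \<bar>W w\<bar> + Delta n (jj n) > u} \<le> e"
          using n[THEN conjunct2, rule_format, of "{jj n}" "\<lambda>_. W"] by simp
      qed (use 1 e in auto)
    qed
  next
    case (2 G u N Z)
    show ?case
    proof (rule limsup_le_zeroI)
      fix e :: real assume e: "e > 0"
      show "eventually (\<lambda>n. measure M {\<omega> \<in> space M. Max ((\<lambda>j. a_fac (X n) (lam n) \<sigma> j *
                \<bar>ridge_corr (X n) (lam n) (Y n \<omega>) (binit n \<omega>) j\<bar>) ` G n) > u}
         - measure N {z \<in> space N. Max ((\<lambda>j. a_fac (X n) (lam n) \<sigma> j * \<bar>Z n z j\<bar> + Delta n j) ` G n) > u} \<le> e) sequentially"
        using asymptotic[of u e N]
      proof (rule eventually_mono)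
        fix n assume n: "n \<ge> 1 \<and>
          (\<forall>G \<zeta>. G \<subseteq> {..<p n} \<and> (\<forall>j\<in>G. beta0 n $ j = 0) \<and> gaussian_family N G \<zeta> (O' n) \<longrightarrow>
            measure M {\<omega> \<in> space M. \<exists>j\<in>G. u < a_fac (X n) (lam n) \<sigma> j * \<bar>ridge_corr (X n) (lam n) (Y n \<omega>) (binit n \<omega>) j\<bar>}
            - measure N {\<omega> \<in> space N. \<exists>j\<in>G. u < \<bar>\<zeta> j \<omega>\<bar> + Delta n j} \<le> e)"
        then have n1: "n \<ge> 1" by simp
        then have G: "G n \<subseteq> {..<p n}" "\<forall>j\<in>G n. beta0 n $ j = 0" using 2 by auto
        have N: "prob_space N" using 2 by simp
        interpret M: prob_space M by fact
        interpret N: prob_space N by fact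
        show "measure M {\<omega> \<in> space M. Max ((\<lambda>j. a_fac (X n) (lam n) \<sigma> j *
                \<bar>ridge_corr (X n) (lam n) (Y n \<omega>) (binit n \<omega>) j\<bar>) ` G n) > u}
         - measure N {z \<in> space N. Max ((\<lambda>j. a_fac (X n) (lam n) \<sigma> j * \<bar>Z n z j\<bar> + Delta n j) ` G n) > u} \<le> e"
        proof (cases "G n = {}")
          case True
          \<comment> \<open>both events are decided by the same unspecified value \<open>Max {}\<close>\<close>
          then show ?thesis using e by (cases "Max ({} :: real set) > u") (simp_all add: M.prob_space N.prob_space)
        next
          case False
          have finG: "finite (G n)" using G(1) finite_subset by blast
          define C where "C = (\<sigma>\<^sup>2 / real n) \<cdot>\<^sub>m Omega (X n) (lam n)"
          define a where "a j = a_fac (X n) (lam n) \<sigma> j" for j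
          have gZ: "gaussian_family N {..<p n} (\<lambda>j \<omega>. Z n \<omega> j) (\<lambda>i j. C $$ (i, j))"
            unfolding C_def
            by (intro gaussian_vec_family N scaled_Omega_symmetric[OF X_dim[OF n1] n1 lam_pos[OF n1]]
                scaled_Omega_nonneg[OF X_dim[OF n1] n1 lam_pos[OF n1]]) (use 2 n1 in auto)
          \<comment> \<open>The diagonal scaling that brings each \<open>Z n z j\<close> to unit
            variance; it turns the covariance \<open>C\<close> into \<open>O' n\<close>.\<close>
          define B where "B j i = (if i = j then a j else 0)" for i j
          have B: "(\<Sum>i<p n. B j i * f i) = a j * f j" if "j \<in> G n" for j f
            using that G(1) by (auto simp: B_def if_distrib[of "\<lambda>x. x * _"] cong: if_cong)
          have cov: "(\<Sum>i<p n. \<Sum>i'<p n. B j i * B k i' * C $$ (i, i')) = O' n j k" if "j \<in> G n" "k \<in> G n" for j k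
          proof -
            have "(\<Sum>i<p n. \<Sum>i'<p n. B j i * B k i' * C $$ (i, i')) = (\<Sum>i<p n. B j i * (\<Sum>i'<p n. B k i' * C $$ (i, i')))"
              by (simp add: sum_distrib_left ac_simps)
            also have "\<dots> = a j * (a k * C $$ (j, k))" unfolding B[OF that(1)] B[OF that(2)] ..
            also have "\<dots> = O' n j k"
              using subsetD[OF G(1) that(1)] subsetD[OF G(1) that(2)] Omega_carrier[OF X_dim[OF n1] n1 lam_pos[OF n1]] by (auto simp: O'_def C_def a_def)
            finally show ?thesis .
          qed
          have "gaussian_family N (G n) (\<lambda>j \<omega>. \<Sum>i<p n. B j i * Z n \<omega> i) (O' n)"
            using gaussian_family_linear[OF gZ finG, of B] cov unfolding gaussian_family_def by (auto cong: sum.cong)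
          note bound = n[THEN conjunct2, rule_format, OF conjI[OF G(1) conjI[OF G(2) this]]]
          have "(\<exists>j\<in>G n. u < \<bar>\<Sum>i<p n. B j i * Z n z i\<bar> + Delta n j) \<longleftrightarrow> (\<exists>j\<in>G n. u < a j * \<bar>Z n z j\<bar> + Delta n j)" for z
          proof (intro bex_cong refl)
            fix j assume j: "j \<in> G n"
            then have "a j > 0" using a_pos[OF n1, of j] G(1) by (auto simp: a_def)
            then show "u < \<bar>\<Sum>i<p n. B j i * Z n z i\<bar> + Delta n j \<longleftrightarrow> u < a j * \<bar>Z n z j\<bar> + Delta n j"
              unfolding B[OF j] by (simp add: abs_mult)
          qed
          then show ?thesis using bound finG False by (simp add: Max_gr_iff a_def)
        qed
      qed (use 2 e in auto)
    qed
  qed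
qed

end
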